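(* Let $M_0$ be a Riemannian manifold with a Lie structure $(M,\mathcal V,g)$ at infinity, with $A=A_{\mathcal V}\to M$ orientable, and let $W\to M$ be a Clifford module over $M$. Then the (generalized) Dirac operator on $W$ is generated by $\mathcal V$: $$\not\!\! D^W\in\mathrm{Diff}(\mathcal V;W).$$
   Context: Manifolds may have corners: they are locally modelled on $[0,\infty)^k\times\mathbb R^{n-k}$, and each hyperface (codimension one boundary face) $H$ is assumed embedded with a smooth defining function $x_H\ge 0$, $H=\{x_H=0\}$, $dx_H\ne 0$ on $H$. $\partial M$ is the union of all hyperfaces and $M\smallsetminus\partial M$ is the interior. A smooth manifold has no corners. A structural Lie algebra of vector fields on $M$ is a real subspace $\mathcal V\subset\Gamma(TM)$ that (i) is closed under Lie brackets, (ii) is closed under multiplication by $C^\infty(M)$ and is a finitely generated projective $C^\infty(M)$-module, (iii) consists of vector fields tangent to all faces of $M$. By the Serre–Swan theorem there is a vector bundle $A=A_{\mathcal V}\to M$ with $\mathcal V\cong\Gamma(A)$ as $C^\infty(M)$-modules, and a bundle map $\varrho:A\to TM$ (the anchor) inducing on sections the inclusion $\mathcal V\subset\Gamma(TM)$. For $X\in\Gamma(A)$, $X(f)=\partial_Xf$ denotes the action of the vector field $\varrho(X)$ on $f$. A Lie structure at infinity on a smooth manifold $M_0$ is a pair $(M,\mathcal V)$ where $M$ is a compact manifold, possibly with corners, with interior $M_0$, $\mathcal V$ is a structural Lie algebra of vector fields on $M$, and $\varrho|_{M_0}:A|_{M_0}\to TM_0$ is a fiberwise isomorphism. With a Riemannian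 metric $g$ on $A$ (a smooth positive definite symmetric 2-tensor on $A$ over all of $M$), which induces a Riemannian metric $g$ on $M_0$, one calls $M_0$ a Riemannian manifold with a Lie structure $(M,\mathcal V,g)$ at infinity. $\mathrm{Diff}(\mathcal V)$ is the algebra of differential operators on $C^\infty(M)$ generated by $\mathcal V$ (acting as derivations) and multiplications by functions in $C^\infty(M)$. For vector bundles $E_1,E_2\to M$, embed $E_i\hookrightarrow M\times\mathbb C^{N_i}$ and let $e_i\in M_{N_i}(C^\infty(M))$ be a projection with pointwise range $E_i$; then $\mathrm{Diff}(\mathcal V;E_1,E_2):=e_2M_{N_2\times N_1}(\mathrm{Diff}(\mathcal V))e_1$ (independent of choices), and $\mathrm{Diff}(\mathcal V;E):=\mathrm{Diff}(\mathcal V;E,E)$. An $A^*$-valued connection on a vector bundle $E\to M$ is a differential operator $D:\Gamma(E)\to\Gamma(E\otimes A^* )$ with $D_X(f\xi)=fD_X\xi+X(f)\xi$ and $D_{fX}\xi=fD_X\xi$ for $X\in\Gamma(A)$, $f\in C^\infty(M)$, $\xi\in\Gamma(E)$. The Levi-Civita connection of $(M_0,g)$ extends to an $A^*$-valued connection $\nabla$ on $A$. A Clifford module over $M$ is a complex vector bundle $W\to M$ with a positive definite product $\langle\cdot,\cdot\rangle$, anti-linear in the second argument, an $A^*$-valued connection $\nabla^W$, and a linear bundle map $A\otimes W\to W$, $X\otimes\varphi\mapsto X\cdot\varphi$ (Clifford multiplication) such that for $X,Y\in\Gamma(A)$ and $\varphi,\psi\in\Gamma(W)$: (1) $(X\cdot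 Y+Y\cdot X+2g(X,Y))\cdot\varphi=0$; (2) $\partial_X\langle\psi,\varphi\rangle=\langle\nabla^W_X\psi,\varphi\rangle+\langle\psi,\nabla^W_X\varphi\rangle$; (3) Clifford multiplication is skew-symmetric: $\langle X\cdot\psi,\varphi\rangle=-\langle\psi,X\cdot\varphi\rangle$; (4) $\nabla^W_X(Y\cdot\varphi)=(\nabla_XY)\cdot\varphi+Y\cdot(\nabla^W_X\varphi)$. The generalized Dirac operator of $W$ is the composition $\not\!\! D^W:=\cdot\circ(\mathrm{id}\otimes\#)\circ\nabla^W$: $$\Gamma(W)\xrightarrow{\nabla^W}\Gamma(W\otimes A^* )\xrightarrow{\mathrm{id}\otimes\#}\Gamma(W\otimes A)\xrightarrow{\ \cdot\ }\Gamma(W),$$ where $\#:A^*\to A$ is the isomorphism given by $g$ and the last map is Clifford multiplication. *)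

theory Defs
  imports "HOL-Analysis.Analysis"
begin

section \<open>Smooth functions on arbitrary subsets of a Euclidean space\<close>

text \<open>\<open>Ck_on k S f\<close> is meant for open \<open>S\<close>; the clause for \<open>Suc k\<close> asks for total
  differentiability with all directional derivatives of class \<open>C\<^sup>k\<close>.\<close>

primrec Ck_on :: "nat \<Rightarrow> 'v::euclidean_space set \<Rightarrow> ('v \<Rightarrow> 'b::real_normed_vector) \<Rightarrow> bool" where
  "Ck_on 0 S f \<longleftrightarrow> continuous_on S f"
| "Ck_on (Suc k) S f \<longleftrightarrow> (\<forall>x\<in>S. f differentiable (at x)) \<and>
     (\<forall>v. Ck_on k S (\<lambda>x. frechet_derivative f (at x) v))"

text \<open>On a set that is not open (such as a relatively open subset of a model corner), smoothness
  means the existence of smooth extensions to open neighbourhoods.\<close>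

definition smooth_on :: "'v::euclidean_space set \<Rightarrow> ('v \<Rightarrow> 'b::real_normed_vector) \<Rightarrow> bool" where
  "smooth_on S f \<longleftrightarrow>
     (\<forall>x\<in>S. \<exists>T g. open T \<and> x \<in> T \<and> (\<forall>k. Ck_on k T g) \<and> (\<forall>y\<in>S \<inter> T. g y = f y))"


section \<open>Manifolds with corners\<close>

text \<open>The underlying topological space of the manifold is all of the type \<open>'a\<close>.  The factor
  \<open>[0,\<infinity>)\<^sup>k \<times> \<real>\<^sup>n\<^sup>-\<^sup>k\<close> of the local model is realised inside the coordinate
  subspace of \<^typ>\<open>real ^ 'n\<close> spanned by the axes in \<open>directions M\<close>, so that
  \<open>n = card (directions M)\<close>, and \<open>n = 0\<close> is possible although index types are nonempty.
  A chart \<open>(U, K, \<phi>)\<close> records its domain \<open>U\<close>, the set \<open>K\<close> of the coordinates that are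
  restricted to \<open>[0,\<infinity>)\<close>, and the coordinate map \<open>\<phi>\<close>.\<close>

record ('a, 'n) manifold =
  directions :: "'n set"
  charts :: "('a set \<times> 'n set \<times> ('a \<Rightarrow> real ^ 'n)) set"

definition corner_model :: "'n::finite set \<Rightarrow> 'n set \<Rightarrow> (real ^ 'n) set" where
  "corner_model J K = {x. (\<forall>i\<in>K. 0 \<le> x $ i) \<and> (\<forall>i. i \<notin> J \<longrightarrow> x $ i = 0)}"

definition corner_atlas :: "('a::{t2_space,second_countable_topology}, 'n::finite) manifold \<Rightarrow> bool" where
  "corner_atlas M \<longleftrightarrow>
     (\<Union>(U, K, \<phi>)\<in>charts M. U) = UNIV \<and>
     (\<forall>(U, K, \<phi>)\<in>charts M. open U \<and> K \<subseteq> directions M \<and>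
        openin (top_of_set (corner_model (directions M) K)) (\<phi> ` U) \<and>
        homeomorphism U (\<phi> ` U) \<phi> (inv_into U \<phi>)) \<and>
     (\<forall>(U, K, \<phi>)\<in>charts M. \<forall>(U', K', \<phi>')\<in>charts M.
        smooth_on (\<phi> ` (U \<inter> U')) (\<phi>' \<circ> inv_into U \<phi>))"

definition smooth_fun ::
    "('a::topological_space, 'n::finite) manifold \<Rightarrow> 'a set \<Rightarrow> ('a \<Rightarrow> 'b::real_normed_vector) \<Rightarrow> bool" where
  "smooth_fun M U f \<longleftrightarrow>
     (\<forall>(V, K, \<phi>)\<in>charts M. smooth_on (\<phi> ` (U \<inter> V)) (f \<circ> inv_into V \<phi>))"

text \<open>\<open>C\<^sup>\<infinity>(U)\<close> for an open set \<open>U\<close>; functions on \<open>U\<close> are represented by their extension by zero,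
  which is no condition for \<open>U = UNIV\<close>.\<close>

definition Cinf ::
    "('a::topological_space, 'n::finite) manifold \<Rightarrow> 'a set \<Rightarrow> ('a \<Rightarrow> 'b::real_normed_vector) set" where
  "Cinf M U = {f. smooth_fun M U f \<and> (\<forall>p. p \<notin> U \<longrightarrow> f p = 0)}"

text \<open>The tangent space at \<open>p\<close> consists of the point derivations of the real algebra \<open>C\<^sup>\<infinity>(M)\<close>
  (made extensional by the value \<open>0\<close> on functions that are not smooth).\<close>

definition tangent_space ::
    "('a::topological_space, 'n::finite) manifold \<Rightarrow> 'a \<Rightarrow> (('a \<Rightarrow> real) \<Rightarrow> real) set" where
  "tangent_space M p = {v.
     (\<forall>f\<in>Cinf M UNIV. \<forall>h\<in>Cinf M UNIV.
        v (\<lambda>q. f q + h q) = v f + v h \<and>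
        v (\<lambda>q. f q * h q) = f p * v h + v f * h p) \<and>
     (\<forall>f\<in>Cinf M UNIV. \<forall>a. v (\<lambda>q. a * f q) = a * v f) \<and>
     (\<forall>f. f \<notin> Cinf M UNIV \<longrightarrow> v f = 0)}"

text \<open>A smooth vector field \<open>X\<close> on \<open>U\<close> is identified with its action \<open>f \<mapsto> X(f)\<close> on \<open>C\<^sup>\<infinity>(U)\<close>;
  its value at \<open>p\<close> is the tangent vector \<open>f \<mapsto> X(f)(p)\<close>.\<close>

definition vector_fields ::
    "('a::topological_space, 'n::finite) manifold \<Rightarrow> 'a set \<Rightarrow> (('a \<Rightarrow> real) \<Rightarrow> 'a \<Rightarrow> real) set" where
  "vector_fields M U = {X.
     (\<forall>f\<in>Cinf M U. X f \<in> Cinf M U) \<and>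
     (\<forall>f\<in>Cinf M U. \<forall>h\<in>Cinf M U.
        X (\<lambda>q. f q + h q) = (\<lambda>q. X f q + X h q) \<and>
        X (\<lambda>q. f q * h q) = (\<lambda>q. f q * X h q + X f q * h q)) \<and>
     (\<forall>f\<in>Cinf M U. \<forall>a. X (\<lambda>q. a * f q) = (\<lambda>q. a * X f q)) \<and>
     (\<forall>f. f \<notin> Cinf M U \<longrightarrow> X f = (\<lambda>_. 0))}"

definition lie_bracket ::
    "(('a \<Rightarrow> real) \<Rightarrow> 'a \<Rightarrow> real) \<Rightarrow> (('a \<Rightarrow> real) \<Rightarrow> 'a \<Rightarrow> real) \<Rightarrow> ('a \<Rightarrow> real) \<Rightarrow> 'a \<Rightarrow> real" where
  "lie_bracket X Y = (\<lambda>f p. X (Y f) p - Y (X f) p)"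

definition stratum :: "('a::topological_space, 'n::finite) manifold \<Rightarrow> nat \<Rightarrow> 'a set" where
  "stratum M k = {p. \<exists>(U, K, \<phi>)\<in>charts M. p \<in> U \<and> card {i\<in>K. \<phi> p $ i = 0} = k}"

text \<open>The faces of codimension \<open>k\<close>.\<close>

definition faces :: "('a::topological_space, 'n::finite) manifold \<Rightarrow> nat \<Rightarrow> 'a set set" where
  "faces M k = closure ` components (stratum M k)"

definition mboundary :: "('a::topological_space, 'n::finite) manifold \<Rightarrow> 'a set" where
  "mboundary M = \<Union>(faces M 1)"

definition minterior :: "('a::topological_space, 'n::finite) manifold \<Rightarrow> 'a set" where
  "minterior M = - mboundary M"

text \<open>The value of the differential \<open>dx\<close> at \<open>v \<in> T\<^sub>pM\<close> is \<open>v x\<close>.  Nonvanishing of \<open>dx\<close> on all of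
  \<open>H = {x = 0}\<close> makes \<open>H\<close> embedded: at a point where two local sheets of \<open>H\<close> met, \<open>dx\<close> would be \<open>0\<close>.\<close>

definition hyperface_defining_function ::
    "('a::topological_space, 'n::finite) manifold \<Rightarrow> 'a set \<Rightarrow> ('a \<Rightarrow> real) \<Rightarrow> bool" where
  "hyperface_defining_function M H x \<longleftrightarrow>
     x \<in> Cinf M UNIV \<and> (\<forall>p. 0 \<le> x p) \<and> H = {p. x p = 0} \<and>
     (\<forall>p\<in>H. \<exists>v\<in>tangent_space M p. v x \<noteq> 0)"

definition manifold_with_corners ::
    "('a::{t2_space,second_countable_topology}, 'n::finite) manifold \<Rightarrow> bool" where
  "manifold_with_corners M \<longleftrightarrow>
     corner_atlas M \<and> (\<forall>H\<in>faces M 1. \<exists>x. hyperface_defining_function M H x)"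

text \<open>\<open>T\<^sub>pF\<close> as a subspace of \<open>T\<^sub>pM\<close>.\<close>

definition face_tangent_space ::
    "('a::topological_space, 'n::finite) manifold \<Rightarrow> 'a set \<Rightarrow> 'a \<Rightarrow> (('a \<Rightarrow> real) \<Rightarrow> real) set" where
  "face_tangent_space M F p =
     {v\<in>tangent_space M p. \<forall>f\<in>Cinf M UNIV. (\<forall>q\<in>F. f q = 0) \<longrightarrow> v f = 0}"

definition tangent_to_face ::
    "('a::topological_space, 'n::finite) manifold \<Rightarrow> 'a set \<Rightarrow> (('a \<Rightarrow> real) \<Rightarrow> 'a \<Rightarrow> real) \<Rightarrow> bool" where
  "tangent_to_face M F X \<longleftrightarrow> (\<forall>p\<in>F. (\<lambda>f. X f p) \<in> face_tangent_space M F p)"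


section \<open>Structural Lie algebras of vector fields\<close>

definition free_module ::
    "('a::topological_space, 'n::finite) manifold \<Rightarrow> nat \<Rightarrow> (nat \<Rightarrow> 'a \<Rightarrow> real) set" where
  "free_module M m = {c. (\<forall>i<m. c i \<in> Cinf M UNIV) \<and> (\<forall>i\<ge>m. c i = (\<lambda>_. 0))}"

text \<open>A finitely generated projective module is a direct summand of a free module \<open>C\<^sup>\<infinity>(M)\<^sup>m\<close>
  of finite rank: there are \<open>C\<^sup>\<infinity>(M)\<close>-linear maps \<open>j : \<V> \<rightarrow> C\<^sup>\<infinity>(M)\<^sup>m\<close> and
  \<open>r : C\<^sup>\<infinity>(M)\<^sup>m \<rightarrow> \<V>\<close> with \<open>r \<circ> j = id\<close>.\<close>

definition fg_projective ::
    "('a::topological_space, 'n::finite) manifold \<Rightarrow> (('a \<Rightarrow> real) \<Rightarrow> 'a \<Rightarrow> real) set \<Rightarrow> bool" where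
  "fg_projective M V \<longleftrightarrow> (\<exists>m j r.
     (\<forall>X\<in>V. j X \<in> free_module M m) \<and>
     (\<forall>X\<in>V. \<forall>Y\<in>V. j (\<lambda>f p. X f p + Y f p) = (\<lambda>i p. j X i p + j Y i p)) \<and>
     (\<forall>X\<in>V. \<forall>h\<in>Cinf M UNIV. j (\<lambda>f p. h p * X f p) = (\<lambda>i p. h p * j X i p)) \<and>
     (\<forall>c\<in>free_module M m. r c \<in> V) \<and>
     (\<forall>c\<in>free_module M m. \<forall>d\<in>free_module M m.
        r (\<lambda>i p. c i p + d i p) = (\<lambda>f p. r c f p + r d f p)) \<and>
     (\<forall>c\<in>free_module M m. \<forall>h\<in>Cinf M UNIV. r (\<lambda>i p. h p * c i p) = (\<lambda>f p. h p * r c f p)) \<and>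
     (\<forall>X\<in>V. r (j X) = X))"

definition structural_Lie_algebra ::
    "('a::topological_space, 'n::finite) manifold \<Rightarrow> (('a \<Rightarrow> real) \<Rightarrow> 'a \<Rightarrow> real) set \<Rightarrow> bool" where
  "structural_Lie_algebra M V \<longleftrightarrow>
     V \<subseteq> vector_fields M UNIV \<and>
     (\<lambda>f p. 0) \<in> V \<and>
     (\<forall>X\<in>V. \<forall>Y\<in>V. (\<lambda>f p. X f p + Y f p) \<in> V) \<and>
     (\<forall>X\<in>V. \<forall>a. (\<lambda>f p. a * X f p) \<in> V) \<and>
     (\<forall>X\<in>V. \<forall>Y\<in>V. lie_bracket X Y \<in> V) \<and>
     (\<forall>X\<in>V. \<forall>h\<in>Cinf M UNIV. (\<lambda>f p. h p * X f p) \<in> V) \<and>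
     fg_projective M V \<and>
     (\<forall>X\<in>V. \<forall>k. \<forall>F\<in>faces M k. tangent_to_face M F X)"


section \<open>Vector bundles\<close>

text \<open>A bundle over the field \<open>'k\<close> (real or complex) is given by its fibres, which are linear
  subspaces of one ambient \<open>'k\<close>-vector space with carrier type \<open>'v\<close> and scalar multiplication
  \<open>scal\<close>.  The ambient space carries no topology and need not be finite-dimensional (for any vector
  bundle, the direct sum of all its fibres will do), so this is only an encoding of a family of
  vector spaces.  The smooth structure is given by local trivialisations, written as local frames
  \<open>(U, r, s)\<close>: at each point of the open set \<open>U\<close>, the vectors \<open>s 0, \<dots>, s (r - 1)\<close> form a basis
  of the fibre.\<close>

record ('a, 'k, 'v) vbundle =
  fibre :: "'a \<Rightarrow> 'v set"
  scal :: "'k \<Rightarrow> 'v \<Rightarrow> 'v"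
  frames :: "('a set \<times> nat \<times> (nat \<Rightarrow> 'a \<Rightarrow> 'v)) set"

definition smooth_local_section ::
    "('a::topological_space, 'n::finite) manifold \<Rightarrow> ('a, 'k::real_normed_field, 'v::ab_group_add) vbundle
      \<Rightarrow> 'a set \<Rightarrow> ('a \<Rightarrow> 'v) \<Rightarrow> bool" where
  "smooth_local_section M E U \<sigma> \<longleftrightarrow>
     (\<forall>p\<in>U. \<sigma> p \<in> fibre E p) \<and>
     (\<forall>(V, r, s)\<in>frames E. \<exists>c. (\<forall>i<r. smooth_fun M (U \<inter> V) (c i)) \<and>
        (\<forall>p\<in>U \<inter> V. \<sigma> p = (\<Sum>i<r. scal E (c i p) (s i p))))"

definition local_frame ::
    "('a::topological_space, 'n::finite) manifold \<Rightarrow> ('a, 'k::real_normed_field, 'v::ab_group_add) vbundle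
      \<Rightarrow> 'a set \<times> nat \<times> (nat \<Rightarrow> 'a \<Rightarrow> 'v) \<Rightarrow> bool" where
  "local_frame M E = (\<lambda>(U, r, s). open U \<and>
     (\<forall>p\<in>U. inj_on (\<lambda>i. s i p) {..<r} \<and>
        \<not> module.dependent (scal E) ((\<lambda>i. s i p) ` {..<r}) \<and>
        module.span (scal E) ((\<lambda>i. s i p) ` {..<r}) = fibre E p) \<and>
     (\<forall>i<r. smooth_local_section M E U (s i)))"

text \<open>Since the local frames in \<open>frames E\<close> have to be smooth in the sense of each other, their
  transition functions are smooth.\<close>

definition vector_bundle ::
    "('a::topological_space, 'n::finite) manifold \<Rightarrow> ('a, 'k::real_normed_field, 'v::ab_group_add) vbundle
      \<Rightarrow> bool" where
  "vector_bundle M E \<longleftrightarrow>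
     vector_space (scal E) \<and>
     (\<forall>p. module.subspace (scal E) (fibre E p)) \<and>
     (\<Union>(U, r, s)\<in>frames E. U) = UNIV \<and>
     (\<forall>fr\<in>frames E. local_frame M E fr)"

definition sections ::
    "('a::topological_space, 'n::finite) manifold \<Rightarrow> ('a, 'k::real_normed_field, 'v::ab_group_add) vbundle
      \<Rightarrow> ('a \<Rightarrow> 'v) set" where
  "sections M E = {\<sigma>. smooth_local_section M E UNIV \<sigma>}"

definition det_nat :: "nat \<Rightarrow> (nat \<Rightarrow> nat \<Rightarrow> real) \<Rightarrow> real" where
  "det_nat r c = (\<Sum>\<pi> | \<pi> permutes {..<r}. of_int (sign \<pi>) * (\<Prod>i<r. c i (\<pi> i)))"

definition orientable ::
    "('a::topological_space, 'n::finite) manifold \<Rightarrow> ('a, real, 'v::ab_group_add) vbundle \<Rightarrow> bool" where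
  "orientable M E \<longleftrightarrow> (\<exists>\<F>.
     (\<forall>fr\<in>\<F>. local_frame M E fr) \<and> (\<Union>(U, r, s)\<in>\<F>. U) = UNIV \<and>
     (\<forall>(U, r, s)\<in>\<F>. \<forall>(U', r', s')\<in>\<F>. \<forall>p\<in>U \<inter> U'. r = r' \<and>
        (\<exists>c. (\<forall>j<r. s' j p = (\<Sum>i<r. scal E (c i j) (s i p))) \<and> 0 < det_nat r c)))"

text \<open>Smooth sections of \<open>E \<otimes> A\<^sup>*\<close> for a real bundle \<open>A\<close>, where the fibre of \<open>E \<otimes> A\<^sup>*\<close> at \<open>p\<close> is
  taken to be the space of real-linear maps from \<open>A\<^sub>p\<close> to \<open>E\<^sub>p\<close> (with \<open>w \<otimes> \<alpha>\<close> acting as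
  \<open>a \<mapsto> \<alpha>(a) w\<close>), extended by \<open>0\<close> outside \<open>A\<^sub>p\<close>.\<close>

definition tensor_dual_sections ::
    "('a::topological_space, 'n::finite) manifold \<Rightarrow> ('a, real, 'e::ab_group_add) vbundle
      \<Rightarrow> ('a, 'k::real_normed_field, 'v::ab_group_add) vbundle \<Rightarrow> ('a \<Rightarrow> 'e \<Rightarrow> 'v) set" where
  "tensor_dual_sections M A E = {\<Phi>.
     (\<forall>p. \<forall>a\<in>fibre A p. \<Phi> p a \<in> fibre E p \<and>
        (\<forall>b\<in>fibre A p. \<Phi> p (a + b) = \<Phi> p a + \<Phi> p b) \<and>
        (\<forall>t. \<Phi> p (scal A t a) = scal E (of_real t) (\<Phi> p a))) \<and>
     (\<forall>p a. a \<notin> fibre A p \<longrightarrow> \<Phi> p a = 0) \<and>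
     (\<forall>(U, r, s)\<in>frames A. \<forall>i<r. smooth_local_section M E U (\<lambda>p. \<Phi> p (s i p)))}"


section \<open>Lie structures at infinity\<close>

text \<open>\<open>anchor_field M \<rho> X\<close> is the vector field \<open>\<rho>(X)\<close>; its action on \<open>f\<close> is \<open>X(f) = \<partial>\<^sub>X f\<close>.\<close>

definition anchor_field ::
    "('a::topological_space, 'n::finite) manifold \<Rightarrow> ('a \<Rightarrow> 'e \<Rightarrow> ('a \<Rightarrow> real) \<Rightarrow> real)
      \<Rightarrow> ('a \<Rightarrow> 'e) \<Rightarrow> ('a \<Rightarrow> real) \<Rightarrow> 'a \<Rightarrow> real" where
  "anchor_field M \<rho> X = (\<lambda>f p. \<rho> p (X p) f)"

definition bundle_map_to_tangent ::
    "('a::topological_space, 'n::finite) manifold \<Rightarrow> ('a, real, 'e::ab_group_add) vbundle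
      \<Rightarrow> ('a \<Rightarrow> 'e \<Rightarrow> ('a \<Rightarrow> real) \<Rightarrow> real) \<Rightarrow> bool" where
  "bundle_map_to_tangent M A \<rho> \<longleftrightarrow>
     (\<forall>p. \<forall>a\<in>fibre A p. \<rho> p a \<in> tangent_space M p \<and>
        (\<forall>b\<in>fibre A p. \<rho> p (a + b) = (\<lambda>f. \<rho> p a f + \<rho> p b f)) \<and>
        (\<forall>t. \<rho> p (scal A t a) = (\<lambda>f. t * \<rho> p a f))) \<and>
     (\<forall>(U, r, s)\<in>frames A. \<forall>i<r. \<forall>f\<in>Cinf M UNIV. smooth_fun M U (\<lambda>p. \<rho> p (s i p) f))"

text \<open>\<open>(A, \<rho>)\<close> is the bundle of \<open>\<V>\<close> provided by the Serre--Swan theorem: on sections, the anchor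
  \<open>\<rho>\<close> identifies \<open>\<Gamma>(A)\<close> with \<open>\<V> \<subseteq> \<Gamma>(TM)\<close> (as \<open>C\<^sup>\<infinity>(M)\<close>-modules, since \<open>\<rho>\<close> is fibrewise linear).\<close>

definition structural_bundle ::
    "('a::topological_space, 'n::finite) manifold \<Rightarrow> (('a \<Rightarrow> real) \<Rightarrow> 'a \<Rightarrow> real) set
      \<Rightarrow> ('a, real, 'e::ab_group_add) vbundle \<Rightarrow> ('a \<Rightarrow> 'e \<Rightarrow> ('a \<Rightarrow> real) \<Rightarrow> real) \<Rightarrow> bool" where
  "structural_bundle M V A \<rho> \<longleftrightarrow>
     vector_bundle M A \<and> bundle_map_to_tangent M A \<rho> \<and>
     bij_betw (anchor_field M \<rho>) (sections M A) V"

definition Lie_structure_at_infinity ::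
    "('a::{t2_space,second_countable_topology}, 'n::finite) manifold
      \<Rightarrow> (('a \<Rightarrow> real) \<Rightarrow> 'a \<Rightarrow> real) set
      \<Rightarrow> ('a, real, 'e::ab_group_add) vbundle \<Rightarrow> ('a \<Rightarrow> 'e \<Rightarrow> ('a \<Rightarrow> real) \<Rightarrow> real) \<Rightarrow> bool" where
  "Lie_structure_at_infinity M V A \<rho> \<longleftrightarrow>
     manifold_with_corners M \<and> compact (UNIV :: 'a set) \<and>
     structural_Lie_algebra M V \<and> structural_bundle M V A \<rho> \<and>
     (\<forall>p\<in>minterior M. bij_betw (\<rho> p) (fibre A p) (tangent_space M p))"

definition bundle_metric ::
    "('a::topological_space, 'n::finite) manifold \<Rightarrow> ('a, real, 'e::ab_group_add) vbundle
      \<Rightarrow> ('a \<Rightarrow> 'e \<Rightarrow> 'e \<Rightarrow> real) \<Rightarrow> bool" where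
  "bundle_metric M A g \<longleftrightarrow>
     (\<forall>p. \<forall>a\<in>fibre A p. \<forall>b\<in>fibre A p.
        g p a b = g p b a \<and>
        (\<forall>c\<in>fibre A p. g p (a + b) c = g p a c + g p b c) \<and>
        (\<forall>t. g p (scal A t a) b = t * g p a b)) \<and>
     (\<forall>p. \<forall>a\<in>fibre A p. a \<noteq> 0 \<longrightarrow> 0 < g p a a) \<and>
     (\<forall>(U, r, s)\<in>frames A. \<forall>i<r. \<forall>j<r. smooth_fun M U (\<lambda>p. g p (s i p) (s j p)))"

definition Riemannian_Lie_structure ::
    "('a::{t2_space,second_countable_topology}, 'n::finite) manifold
      \<Rightarrow> (('a \<Rightarrow> real) \<Rightarrow> 'a \<Rightarrow> real) set
      \<Rightarrow> ('a, real, 'e::ab_group_add) vbundle \<Rightarrow> ('a \<Rightarrow> 'e \<Rightarrow> ('a \<Rightarrow> real) \<Rightarrow> real)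
      \<Rightarrow> ('a \<Rightarrow> 'e \<Rightarrow> 'e \<Rightarrow> real) \<Rightarrow> bool" where
  "Riemannian_Lie_structure M V A \<rho> g \<longleftrightarrow>
     Lie_structure_at_infinity M V A \<rho> \<and> bundle_metric M A g"


section \<open>Connections\<close>

text \<open>An \<open>A\<^sup>*\<close>-valued connection on \<open>E\<close>, as a map \<open>D\<close> from \<open>\<Gamma>(E)\<close> to \<open>\<Gamma>(E \<otimes> A\<^sup>*)\<close>; here
  \<open>D\<^sub>X \<xi>\<close> is the section \<open>p \<mapsto> D \<xi> p (X p)\<close>.  The Leibniz rule makes a linear map \<open>D\<close> a
  differential operator of order one, so no separate condition expresses that.\<close>

definition A_connection ::
    "('a::topological_space, 'n::finite) manifold \<Rightarrow> ('a, real, 'e::ab_group_add) vbundle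
      \<Rightarrow> ('a \<Rightarrow> 'e \<Rightarrow> ('a \<Rightarrow> real) \<Rightarrow> real)
      \<Rightarrow> ('a, 'k::real_normed_field, 'v::ab_group_add) vbundle
      \<Rightarrow> (('a \<Rightarrow> 'v) \<Rightarrow> 'a \<Rightarrow> 'e \<Rightarrow> 'v) \<Rightarrow> bool" where
  "A_connection M A \<rho> E D \<longleftrightarrow>
     (\<forall>\<xi>\<in>sections M E. D \<xi> \<in> tensor_dual_sections M A E) \<and>
     (\<forall>\<xi>\<in>sections M E. \<forall>\<eta>\<in>sections M E.
        D (\<lambda>p. \<xi> p + \<eta> p) = (\<lambda>p a. D \<xi> p a + D \<eta> p a)) \<and>
     (\<forall>\<xi>\<in>sections M E. \<forall>z. D (\<lambda>p. scal E z (\<xi> p)) = (\<lambda>p a. scal E z (D \<xi> p a))) \<and>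
     (\<forall>X\<in>sections M A. \<forall>f\<in>Cinf M UNIV. \<forall>\<xi>\<in>sections M E. \<forall>p.
        D (\<lambda>q. scal E (of_real (f q)) (\<xi> q)) p (X p) =
          scal E (of_real (f p)) (D \<xi> p (X p)) +
          scal E (of_real (anchor_field M \<rho> X f p)) (\<xi> p)) \<and>
     (\<forall>X\<in>sections M A. \<forall>f\<in>Cinf M UNIV. \<forall>\<xi>\<in>sections M E. \<forall>p.
        D \<xi> p (scal A (f p) (X p)) = scal E (of_real (f p)) (D \<xi> p (X p)))"

text \<open>The Levi-Civita connection on an open subset \<open>U\<close> of the interior, for a Riemannian metric
  given as a map \<open>h\<close> on pairs of vector fields on \<open>U\<close>.\<close>

definition Levi_Civita ::
    "('a::topological_space, 'n::finite) manifold \<Rightarrow> 'a set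
      \<Rightarrow> ((('a \<Rightarrow> real) \<Rightarrow> 'a \<Rightarrow> real) \<Rightarrow> (('a \<Rightarrow> real) \<Rightarrow> 'a \<Rightarrow> real) \<Rightarrow> 'a \<Rightarrow> real)
      \<Rightarrow> ((('a \<Rightarrow> real) \<Rightarrow> 'a \<Rightarrow> real) \<Rightarrow> (('a \<Rightarrow> real) \<Rightarrow> 'a \<Rightarrow> real)
            \<Rightarrow> ('a \<Rightarrow> real) \<Rightarrow> 'a \<Rightarrow> real) \<Rightarrow> bool" where
  "Levi_Civita M U h D \<longleftrightarrow>
     (\<forall>X\<in>vector_fields M U. \<forall>Y\<in>vector_fields M U.
        D X Y \<in> vector_fields M U \<and>
        (\<forall>Z\<in>vector_fields M U.
           D (\<lambda>f p. X f p + Z f p) Y = (\<lambda>f p. D X Y f p + D Z Y f p) \<and>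
           D X (\<lambda>f p. Y f p + Z f p) = (\<lambda>f p. D X Y f p + D X Z f p)) \<and>
        (\<forall>u\<in>Cinf M U.
           D (\<lambda>f p. u p * X f p) Y = (\<lambda>f p. u p * D X Y f p) \<and>
           D X (\<lambda>f p. u p * Y f p) = (\<lambda>f p. u p * D X Y f p + X u p * Y f p)) \<and>
        (\<lambda>f p. D X Y f p - D Y X f p) = lie_bracket X Y \<and>
        (\<forall>Z\<in>vector_fields M U. X (h Y Z) = (\<lambda>p. h (D X Y) Z p + h Y (D X Z) p)))"

text \<open>\<open>anchor_value M \<rho> U p a X\<close>: the vector field \<open>X\<close> on the open set \<open>U\<close> has the value
  \<open>\<rho>(a)\<close> at \<open>p \<in> U\<close>.  (Elements of \<^const>\<open>tangent_space\<close> act on global functions, which have to be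
  restricted to \<open>U\<close>.)\<close>

definition anchor_value ::
    "('a::topological_space, 'n::finite) manifold \<Rightarrow> ('a \<Rightarrow> 'e \<Rightarrow> ('a \<Rightarrow> real) \<Rightarrow> real)
      \<Rightarrow> 'a set \<Rightarrow> 'a \<Rightarrow> 'e \<Rightarrow> (('a \<Rightarrow> real) \<Rightarrow> 'a \<Rightarrow> real) \<Rightarrow> bool" where
  "anchor_value M \<rho> U p a X \<longleftrightarrow>
     (\<forall>f\<in>Cinf M UNIV. X (\<lambda>q. if q \<in> U then f q else 0) p = \<rho> p a f)"

text \<open>The Riemannian metric on the interior that is induced by \<open>g\<close> via \<open>\<rho>\<close>.\<close>

definition interior_metric ::
    "('a::topological_space, 'n::finite) manifold \<Rightarrow> ('a, real, 'e::ab_group_add) vbundle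
      \<Rightarrow> ('a \<Rightarrow> 'e \<Rightarrow> ('a \<Rightarrow> real) \<Rightarrow> real) \<Rightarrow> ('a \<Rightarrow> 'e \<Rightarrow> 'e \<Rightarrow> real)
      \<Rightarrow> (('a \<Rightarrow> real) \<Rightarrow> 'a \<Rightarrow> real) \<Rightarrow> (('a \<Rightarrow> real) \<Rightarrow> 'a \<Rightarrow> real) \<Rightarrow> 'a \<Rightarrow> real" where
  "interior_metric M A \<rho> g X Y = (\<lambda>p. if p \<in> minterior M
     then g p (THE a. a \<in> fibre A p \<and> anchor_value M \<rho> (minterior M) p a X)
              (THE b. b \<in> fibre A p \<and> anchor_value M \<rho> (minterior M) p b Y)
     else 0)"

text \<open>\<open>D\<close> is the extension to an \<open>A\<^sup>*\<close>-valued connection on \<open>A\<close> of the Levi-Civita connection of the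
  interior; \<open>X'\<close>, \<open>Y'\<close> are the restrictions of \<open>\<rho>(X)\<close>, \<open>\<rho>(Y)\<close> to the interior.\<close>

definition extends_Levi_Civita ::
    "('a::topological_space, 'n::finite) manifold \<Rightarrow> ('a, real, 'e::ab_group_add) vbundle
      \<Rightarrow> ('a \<Rightarrow> 'e \<Rightarrow> ('a \<Rightarrow> real) \<Rightarrow> real) \<Rightarrow> ('a \<Rightarrow> 'e \<Rightarrow> 'e \<Rightarrow> real)
      \<Rightarrow> (('a \<Rightarrow> 'e) \<Rightarrow> 'a \<Rightarrow> 'e \<Rightarrow> 'e) \<Rightarrow> bool" where
  "extends_Levi_Civita M A \<rho> g D \<longleftrightarrow>
     A_connection M A \<rho> A D \<and>
     (\<exists>D\<^sub>0. Levi_Civita M (minterior M) (interior_metric M A \<rho> g) D\<^sub>0 \<and>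
        (\<forall>X\<in>sections M A. \<forall>Y\<in>sections M A.
         \<forall>X'\<in>vector_fields M (minterior M). \<forall>Y'\<in>vector_fields M (minterior M).
           (\<forall>p\<in>minterior M. anchor_value M \<rho> (minterior M) p (X p) X' \<and>
                             anchor_value M \<rho> (minterior M) p (Y p) Y') \<longrightarrow>
           (\<forall>p\<in>minterior M. anchor_value M \<rho> (minterior M) p (D Y p (X p)) (D\<^sub>0 X' Y'))))"


section \<open>Differential operators generated by a structural Lie algebra\<close>

text \<open>The action of a real vector field on complex-valued functions.\<close>

definition complex_action ::
    "(('a \<Rightarrow> real) \<Rightarrow> 'a \<Rightarrow> real) \<Rightarrow> ('a \<Rightarrow> complex) \<Rightarrow> 'a \<Rightarrow> complex" where
  "complex_action X u = (\<lambda>p. Complex (X (\<lambda>q. Re (u q)) p) (X (\<lambda>q. Im (u q)) p))"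

text \<open>The algebra \<open>Diff(\<V>)\<close>, acting on complex-valued functions.  Multiplications by constants
  provide scalar multiples and the zero operator.\<close>

inductive_set Diff ::
    "('a::topological_space, 'n::finite) manifold \<Rightarrow> (('a \<Rightarrow> real) \<Rightarrow> 'a \<Rightarrow> real) set
      \<Rightarrow> (('a \<Rightarrow> complex) \<Rightarrow> 'a \<Rightarrow> complex) set"
  for M V where
  derivation: "X \<in> V \<Longrightarrow> complex_action X \<in> Diff M V"
| multiplication: "f \<in> Cinf M UNIV \<Longrightarrow> (\<lambda>u p. f p * u p) \<in> Diff M V"
| sum: "P \<in> Diff M V \<Longrightarrow> Q \<in> Diff M V \<Longrightarrow> (\<lambda>u p. P u p + Q u p) \<in> Diff M V"
| composition: "P \<in> Diff M V \<Longrightarrow> Q \<in> Diff M V \<Longrightarrow> (\<lambda>u. P (Q u)) \<in> Diff M V"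

text \<open>An embedding \<open>\<iota>\<close> of \<open>E\<close> into \<open>M \<times> \<complex>\<^sup>N\<close> together with a projection \<open>e\<close> in \<open>M\<^sub>N(C\<^sup>\<infinity>(M))\<close> whose
  pointwise range is the image of \<open>E\<close>; vectors in \<open>\<complex>\<^sup>N\<close> are functions on \<^typ>\<open>nat\<close> that vanish from
  \<open>N\<close> on.\<close>

definition bundle_embedding ::
    "('a::topological_space, 'n::finite) manifold \<Rightarrow> ('a, complex, 'v::ab_group_add) vbundle
      \<Rightarrow> nat \<Rightarrow> ('a \<Rightarrow> 'v \<Rightarrow> nat \<Rightarrow> complex) \<Rightarrow> (nat \<Rightarrow> nat \<Rightarrow> 'a \<Rightarrow> complex) \<Rightarrow> bool" where
  "bundle_embedding M E N \<iota> e \<longleftrightarrow>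
     (\<forall>p. inj_on (\<iota> p) (fibre E p) \<and>
        (\<forall>v\<in>fibre E p. (\<forall>k\<ge>N. \<iota> p v k = 0) \<and>
           (\<forall>w\<in>fibre E p. \<iota> p (v + w) = (\<lambda>k. \<iota> p v k + \<iota> p w k)) \<and>
           (\<forall>z. \<iota> p (scal E z v) = (\<lambda>k. z * \<iota> p v k)))) \<and>
     (\<forall>(U, r, s)\<in>frames E. \<forall>i<r. \<forall>k<N. smooth_fun M U (\<lambda>p. \<iota> p (s i p) k)) \<and>
     (\<forall>k<N. \<forall>l<N. e k l \<in> Cinf M UNIV) \<and>
     (\<forall>p. \<forall>k<N. \<forall>l<N. (\<Sum>m<N. e k m p * e m l p) = e k l p) \<and>
     (\<forall>p. range (\<lambda>z k. if k < N then \<Sum>l<N. e k l p * z l else 0) = \<iota> p ` fibre E p)"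

text \<open>\<open>Diff(\<V>; E\<^sub>1, E\<^sub>2) = e\<^sub>2 M\<^bsub>N\<^sub>2\<times>N\<^sub>1\<^esub>(Diff(\<V>)) e\<^sub>1\<close>, where \<open>\<Gamma>(E\<^sub>i)\<close> is identified with
  \<open>e\<^sub>i C\<^sup>\<infinity>(M)\<^bsup>N\<^sub>i\<^esup>\<close> by means of \<open>\<iota>\<^sub>i\<close>.  The set does not depend on the choice of the embeddings
  and projections, so it does not matter that the choice is made for each operator.\<close>

definition Diff_bundle ::
    "('a::topological_space, 'n::finite) manifold \<Rightarrow> (('a \<Rightarrow> real) \<Rightarrow> 'a \<Rightarrow> real) set
      \<Rightarrow> ('a, complex, 'v::ab_group_add) vbundle \<Rightarrow> ('a, complex, 'w::ab_group_add) vbundle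
      \<Rightarrow> (('a \<Rightarrow> 'v) \<Rightarrow> 'a \<Rightarrow> 'w) set" where
  "Diff_bundle M V E\<^sub>1 E\<^sub>2 = {P.
     (\<forall>\<xi>\<in>sections M E\<^sub>1. P \<xi> \<in> sections M E\<^sub>2) \<and>
     (\<exists>N\<^sub>1 \<iota>\<^sub>1 e\<^sub>1 N\<^sub>2 \<iota>\<^sub>2 e\<^sub>2 Q.
        bundle_embedding M E\<^sub>1 N\<^sub>1 \<iota>\<^sub>1 e\<^sub>1 \<and> bundle_embedding M E\<^sub>2 N\<^sub>2 \<iota>\<^sub>2 e\<^sub>2 \<and>
        (\<forall>k<N\<^sub>2. \<forall>l<N\<^sub>1. Q k l \<in> Diff M V) \<and>
        (\<forall>\<xi>\<in>sections M E\<^sub>1. \<forall>p. \<forall>k<N\<^sub>2.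
           \<iota>\<^sub>2 p (P \<xi> p) k =
             (\<Sum>m<N\<^sub>2. e\<^sub>2 k m p *
               (\<Sum>l<N\<^sub>1. Q m l (\<lambda>q. \<Sum>j<N\<^sub>1. e\<^sub>1 l j q * \<iota>\<^sub>1 q (\<xi> q) j) p))))}"


section \<open>Clifford modules and the Dirac operator\<close>

definition Hermitian_metric ::
    "('a::topological_space, 'n::finite) manifold \<Rightarrow> ('a, complex, 'w::ab_group_add) vbundle
      \<Rightarrow> ('a \<Rightarrow> 'w \<Rightarrow> 'w \<Rightarrow> complex) \<Rightarrow> bool" where
  "Hermitian_metric M W h \<longleftrightarrow>
     (\<forall>p. \<forall>v\<in>fibre W p. \<forall>w\<in>fibre W p.
        h p v w = cnj (h p w v) \<and>
        (\<forall>u\<in>fibre W p. h p (v + w) u = h p v u + h p w u) \<and>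
        (\<forall>z. h p (scal W z v) w = z * h p v w)) \<and>
     (\<forall>p. \<forall>v\<in>fibre W p. v \<noteq> 0 \<longrightarrow> 0 < Re (h p v v)) \<and>
     (\<forall>(U, r, s)\<in>frames W. \<forall>i<r. \<forall>j<r. smooth_fun M U (\<lambda>p. h p (s i p) (s j p)))"

text \<open>A linear bundle map \<open>A \<otimes> W \<rightarrow> W\<close>, given as a fibrewise bilinear map.\<close>

definition Clifford_map ::
    "('a::topological_space, 'n::finite) manifold \<Rightarrow> ('a, real, 'e::ab_group_add) vbundle
      \<Rightarrow> ('a, complex, 'w::ab_group_add) vbundle \<Rightarrow> ('a \<Rightarrow> 'e \<Rightarrow> 'w \<Rightarrow> 'w) \<Rightarrow> bool" where
  "Clifford_map M A W cl \<longleftrightarrow>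
     (\<forall>p. \<forall>a\<in>fibre A p. \<forall>w\<in>fibre W p. cl p a w \<in> fibre W p \<and>
        (\<forall>b\<in>fibre A p. cl p (a + b) w = cl p a w + cl p b w) \<and>
        (\<forall>v\<in>fibre W p. cl p a (v + w) = cl p a v + cl p a w) \<and>
        (\<forall>t. cl p (scal A t a) w = scal W (of_real t) (cl p a w)) \<and>
        (\<forall>z. cl p a (scal W z w) = scal W z (cl p a w))) \<and>
     (\<forall>(U, r, s)\<in>frames A. \<forall>(U', r', s')\<in>frames W. \<forall>i<r. \<forall>j<r'.
        smooth_local_section M W (U \<inter> U') (\<lambda>p. cl p (s i p) (s' j p)))"

definition Clifford_module ::
    "('a::topological_space, 'n::finite) manifold \<Rightarrow> ('a, real, 'e::ab_group_add) vbundle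
      \<Rightarrow> ('a \<Rightarrow> 'e \<Rightarrow> ('a \<Rightarrow> real) \<Rightarrow> real) \<Rightarrow> ('a \<Rightarrow> 'e \<Rightarrow> 'e \<Rightarrow> real)
      \<Rightarrow> (('a \<Rightarrow> 'e) \<Rightarrow> 'a \<Rightarrow> 'e \<Rightarrow> 'e)
      \<Rightarrow> ('a, complex, 'w::ab_group_add) vbundle \<Rightarrow> ('a \<Rightarrow> 'w \<Rightarrow> 'w \<Rightarrow> complex)
      \<Rightarrow> (('a \<Rightarrow> 'w) \<Rightarrow> 'a \<Rightarrow> 'e \<Rightarrow> 'w) \<Rightarrow> ('a \<Rightarrow> 'e \<Rightarrow> 'w \<Rightarrow> 'w) \<Rightarrow> bool" where
  "Clifford_module M A \<rho> g nabla W h nablaW cl \<longleftrightarrow>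
     vector_bundle M W \<and> Hermitian_metric M W h \<and>
     A_connection M A \<rho> W nablaW \<and> Clifford_map M A W cl \<and>
     (\<forall>X\<in>sections M A. \<forall>Y\<in>sections M A. \<forall>\<phi>\<in>sections M W. \<forall>p.
        cl p (X p) (cl p (Y p) (\<phi> p)) + cl p (Y p) (cl p (X p) (\<phi> p)) +
          scal W (of_real (2 * g p (X p) (Y p))) (\<phi> p) = 0) \<and>
     (\<forall>X\<in>sections M A. \<forall>\<phi>\<in>sections M W. \<forall>\<psi>\<in>sections M W. \<forall>p.
        complex_action (anchor_field M \<rho> X) (\<lambda>q. h q (\<psi> q) (\<phi> q)) p =
          h p (nablaW \<psi> p (X p)) (\<phi> p) + h p (\<psi> p) (nablaW \<phi> p (X p))) \<and>
     (\<forall>X\<in>sections M A. \<forall>\<phi>\<in>sections M W. \<forall>\<psi>\<in>sections M W. \<forall>p.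
        h p (cl p (X p) (\<psi> p)) (\<phi> p) = - h p (\<psi> p) (cl p (X p) (\<phi> p))) \<and>
     (\<forall>X\<in>sections M A. \<forall>Y\<in>sections M A. \<forall>\<phi>\<in>sections M W. \<forall>p.
        nablaW (\<lambda>q. cl q (Y q) (\<phi> q)) p (X p) =
          cl p (nabla Y p (X p)) (\<phi> p) + cl p (Y p) (nablaW \<phi> p (X p)))"

definition dual_fibre :: "('a, real, 'e::ab_group_add) vbundle \<Rightarrow> 'a \<Rightarrow> ('e \<Rightarrow> real) set" where
  "dual_fibre A p = {\<alpha>.
     (\<forall>a\<in>fibre A p. \<forall>b\<in>fibre A p. \<alpha> (a + b) = \<alpha> a + \<alpha> b) \<and>
     (\<forall>a\<in>fibre A p. \<forall>t. \<alpha> (scal A t a) = t * \<alpha> a) \<and>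
     (\<forall>a. a \<notin> fibre A p \<longrightarrow> \<alpha> a = 0)}"

text \<open>The isomorphism \<open># : A\<^sup>* \<rightarrow> A\<close> given by \<open>g\<close>.\<close>

definition sharp ::
    "('a, real, 'e::ab_group_add) vbundle \<Rightarrow> ('a \<Rightarrow> 'e \<Rightarrow> 'e \<Rightarrow> real) \<Rightarrow> 'a \<Rightarrow> ('e \<Rightarrow> real) \<Rightarrow> 'e" where
  "sharp A g p \<alpha> = (THE a. a \<in> fibre A p \<and> (\<forall>b\<in>fibre A p. g p a b = \<alpha> b))"

text \<open>Elements of \<open>W\<^sub>p \<otimes> A\<^sub>p\<close> are encoded as linear maps \<open>\<Psi> : A\<^sub>p\<^sup>* \<rightarrow> W\<^sub>p\<close>, with \<open>w \<otimes> a\<close> acting as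
  \<open>\<beta> \<mapsto> \<beta>(a) w\<close>.  With this encoding, \<open>id \<otimes> #\<close> is composition with \<open>#\<close>, because
  \<open>\<beta>(#\<alpha>) = g(#\<alpha>, #\<beta>) = \<alpha>(#\<beta>)\<close>.\<close>

definition id_tensor_sharp ::
    "('a, real, 'e::ab_group_add) vbundle \<Rightarrow> ('a \<Rightarrow> 'e \<Rightarrow> 'e \<Rightarrow> real) \<Rightarrow> 'a
      \<Rightarrow> ('e \<Rightarrow> 'w) \<Rightarrow> ('e \<Rightarrow> real) \<Rightarrow> 'w" where
  "id_tensor_sharp A g p \<Phi> = (\<lambda>\<beta>. \<Phi> (sharp A g p \<beta>))"

text \<open>Clifford multiplication as a map on \<open>W\<^sub>p \<otimes> A\<^sub>p\<close>: it sends \<open>\<Sum>\<^sub>k w\<^sub>k \<otimes> a\<^sub>k\<close> to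
  \<open>\<Sum>\<^sub>k a\<^sub>k \<cdot> w\<^sub>k\<close>.\<close>

definition Clifford_contraction ::
    "('a, real, 'e::ab_group_add) vbundle \<Rightarrow> ('a, complex, 'w::ab_group_add) vbundle
      \<Rightarrow> ('a \<Rightarrow> 'e \<Rightarrow> 'w \<Rightarrow> 'w) \<Rightarrow> 'a \<Rightarrow> (('e \<Rightarrow> real) \<Rightarrow> 'w) \<Rightarrow> 'w" where
  "Clifford_contraction A W cl p \<Psi> = (THE x. \<exists>m w a.
     (\<forall>k<m::nat. w k \<in> fibre W p \<and> a k \<in> fibre A p) \<and>
     (\<forall>\<beta>\<in>dual_fibre A p. \<Psi> \<beta> = (\<Sum>k<m. scal W (of_real (\<beta> (a k))) (w k))) \<and>
     x = (\<Sum>k<m. cl p (a k) (w k)))"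

definition Dirac_operator ::
    "('a, real, 'e::ab_group_add) vbundle \<Rightarrow> ('a \<Rightarrow> 'e \<Rightarrow> 'e \<Rightarrow> real)
      \<Rightarrow> ('a, complex, 'w::ab_group_add) vbundle \<Rightarrow> (('a \<Rightarrow> 'w) \<Rightarrow> 'a \<Rightarrow> 'e \<Rightarrow> 'w)
      \<Rightarrow> ('a \<Rightarrow> 'e \<Rightarrow> 'w \<Rightarrow> 'w) \<Rightarrow> ('a \<Rightarrow> 'w) \<Rightarrow> 'a \<Rightarrow> 'w" where
  "Dirac_operator A g W nablaW cl =
     (\<lambda>\<phi> p. Clifford_contraction A W cl p (id_tensor_sharp A g p (nablaW \<phi> p)))"

end

theory Submission
  imports Defs
begin

text \<open>Over a compact \<open>M\<close>, Gram--Schmidt and bump functions give finitely many global sections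
  \<open>X\<^sub>j, Y\<^sub>j\<close> of \<open>A\<close> with \<open>a = \<Sum>\<^sub>j g(a, Y\<^sub>j) X\<^sub>j\<close>, and likewise \<open>Z\<^sub>l, T\<^sub>l\<close> of \<open>W\<close> with
  \<open>w = \<Sum>\<^sub>l \<langle>w, T\<^sub>l\<rangle> Z\<^sub>l\<close>.  Since \<open>\<Sum>\<^sub>j X\<^sub>j \<otimes> g(\<cdot>, Y\<^sub>j)\<close> is the identity of \<open>A\<close> and \<open>#\<close> maps
  \<open>g(\<cdot>, Y\<^sub>j)\<close> to \<open>Y\<^sub>j\<close>, the Dirac operator sends \<open>\<xi>\<close> to the sum over \<open>j\<close> of the Clifford products of
  \<open>X\<^sub>j\<close> with the derivatives of \<open>\<xi>\<close> along \<open>Y\<^sub>j\<close>.  In the coordinates \<open>u\<^sub>l = \<langle>\<xi>, T\<^sub>l\<rangle>\<close>, which embed \<open>W\<close>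
  into a trivial bundle with projection matrix \<open>\<langle>Z\<^sub>l, T\<^sub>k\<rangle>\<close>, the Leibniz rule turns this into a
  matrix of operators \<open>u \<mapsto> b u + \<Sum>\<^sub>j a\<^sub>j Y\<^sub>j(u)\<close> with smooth \<open>a\<^sub>j, b\<close>.\<close>

section \<open>Calculus of smooth functions\<close>

lemma Ck_on_subset: "Ck_on k S f \<Longrightarrow> T \<subseteq> S \<Longrightarrow> Ck_on k T f"
  by (induction k arbitrary: f) (auto intro: continuous_on_subset)

text \<open>On an open set the Frechet derivative at a point sees only the values of the function on
  \<open>S\<close>, so equality on \<open>S\<close> passes to all derivatives.\<close>

lemma Ck_on_cong:
  assumes "open S" "\<And>x. x \<in> S \<Longrightarrow> f x = g x" "Ck_on k S f"
  shows "Ck_on k S g"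
  using assms(2,3)
proof (induction k arbitrary: f g)
  case 0
  then show ?case by (simp cong: continuous_on_cong)
next
  case (Suc k)
  have d: "(g has_derivative frechet_derivative f (at x)) (at x)" if "x \<in> S" for x
  proof (rule has_derivative_transform_within_open[OF _ \<open>open S\<close> that])
    show "(f has_derivative frechet_derivative f (at x)) (at x)"
      using Suc.prems(2) that frechet_derivative_works by auto
  qed (use Suc.prems(1) in auto)
  have "frechet_derivative g (at x) = frechet_derivative f (at x)" if "x \<in> S" for x
    using frechet_derivative_at[OF d[OF that]] by simp
  then show ?case
    using Suc.IH[of "\<lambda>x. frechet_derivative f (at x) v" "\<lambda>x. frechet_derivative g (at x) v" for v] Suc.prems d
    by (simp add: differentiableI[OF d])
qed

text \<open>Lets a differentiation rule supply \<open>f'\<close> in explicit form; uniqueness of the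
  derivative identifies it with the \<open>frechet_derivative\<close> in the definition of
  \<open>Ck_on\<close>.\<close>

lemma Ck_on_SucI:
  assumes "open S" "\<And>x. x \<in> S \<Longrightarrow> (f has_derivative f' x) (at x)"
    and "\<And>v. Ck_on k S (\<lambda>x. f' x v)"
  shows "Ck_on (Suc k) S f"
proof -
  have "f' x = frechet_derivative f (at x)" if "x \<in> S" for x
    using frechet_derivative_at[OF assms(2)[OF that]] .
  then have "Ck_on k S (\<lambda>x. frechet_derivative f (at x) v)" for v
    using Ck_on_cong[OF assms(1) _ assms(3)[of v]] by simp
  then show ?thesis
    using assms(2) by (auto simp: differentiable_def)
qed

text \<open>The third part, lowering the order, serves the product, quotient and chain rules below,
  where an undifferentiated factor is multiplied by a derivative.\<close>

lemma Ck_on_SucD: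
  assumes "Ck_on (Suc k) S f"
  shows "x \<in> S \<Longrightarrow> (f has_derivative frechet_derivative f (at x)) (at x)"
    and "Ck_on k S (\<lambda>x. frechet_derivative f (at x) v)"
    and "Ck_on k S f"
proof -
  show "x \<in> S \<Longrightarrow> (f has_derivative frechet_derivative f (at x)) (at x)"
    "Ck_on k S (\<lambda>x. frechet_derivative f (at x) v)"
    using assms by (auto simp flip: frechet_derivative_works)
  show "Ck_on k S f"
    using assms
  proof (induction k arbitrary: f)
    case 0
    then show ?case
      by (auto intro!: continuous_at_imp_continuous_on differentiable_imp_continuous_within)
  next
    case (Suc k)
    then show ?case by (metis Ck_on.simps(2))
  qed
qed

lemma Ck_on_const: "open S \<Longrightarrow> Ck_on k S (\<lambda>x. c)"
proof (induction k arbitrary: c)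
  case (Suc k)
  then show ?case by (intro Ck_on_SucI[where f' = "\<lambda>_ _. 0"]) auto
qed simp

lemma Ck_on_add:
  "open S \<Longrightarrow> Ck_on k S f \<Longrightarrow> Ck_on k S g \<Longrightarrow> Ck_on k S (\<lambda>x. f x + g x)"
proof (induction k arbitrary: f g)
  case 0
  then show ?case by (simp add: continuous_on_add)
next
  case (Suc k)
  note f = Ck_on_SucD[OF Suc.prems(2)] and g = Ck_on_SucD[OF Suc.prems(3)]
  show ?case
    by (rule Ck_on_SucI[OF Suc.prems(1) has_derivative_add[OF f(1) g(1)]
          Suc.IH[OF Suc.prems(1) f(2) g(2)]])
qed

lemma Ck_on_linear:
  "bounded_linear L \<Longrightarrow> open S \<Longrightarrow> Ck_on k S f \<Longrightarrow> Ck_on k S (\<lambda>x. L (f x))"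
proof (induction k arbitrary: f)
  case 0
  then show ?case by (simp add: bounded_linear.continuous_on)
next
  case (Suc k)
  note f = Ck_on_SucD[OF Suc.prems(3)]
  show ?case
    by (rule Ck_on_SucI[OF Suc.prems(2) bounded_linear.has_derivative[OF Suc.prems(1) f(1)]
          Suc.IH[OF Suc.prems(1,2) f(2)]])
qed

lemma Ck_on_bilinear:
  assumes "bounded_bilinear B"
  shows "open S \<Longrightarrow> Ck_on k S f \<Longrightarrow> Ck_on k S g \<Longrightarrow> Ck_on k S (\<lambda>x. B (f x) (g x))"
proof (induction k arbitrary: f g)
  case 0
  then show ?case by (simp add: bounded_bilinear.continuous_on[OF assms])
next
  case (Suc k)
  note f = Ck_on_SucD[OF Suc.prems(2)] and g = Ck_on_SucD[OF Suc.prems(3)]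
  show ?case
    by (rule Ck_on_SucI[OF Suc.prems(1) bounded_bilinear.FDERIV[OF assms f(1) g(1)] Ck_on_add[OF
          Suc.prems(1) Suc.IH[OF Suc.prems(1) f(3) g(2)] Suc.IH[OF Suc.prems(1) f(2) g(3)]]])
qed

text \<open>The derivative in direction \<open>v\<close> is
  \<open>- (inverse (f x) * f' v * inverse (f x))\<close>, built from the inverse itself at the
  lower order and a derivative of \<open>f\<close>, so the induction closes up.\<close>

lemma Ck_on_inverse:
  fixes f :: "'v::euclidean_space \<Rightarrow> 'k::real_normed_field"
  shows "open S \<Longrightarrow> Ck_on k S f \<Longrightarrow> \<forall>x\<in>S. f x \<noteq> 0 \<Longrightarrow> Ck_on k S (\<lambda>x. inverse (f x))"
proof (induction k)
  case 0
  then show ?case by (simp add: continuous_on_inverse)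
next
  case (Suc k)
  note f = Ck_on_SucD[OF Suc.prems(2)]
  note mult = Ck_on_bilinear[OF bounded_bilinear_mult Suc.prems(1)]
    and minus = Ck_on_linear[OF bounded_linear_minus[OF bounded_linear_ident] Suc.prems(1)]
  have inv: "Ck_on k S (\<lambda>x. inverse (f x))"
    using Suc.IH[OF Suc.prems(1) f(3) Suc.prems(3)] .
  show ?case
    by (rule Ck_on_SucI[OF Suc.prems(1) Deriv.has_derivative_inverse[OF _ f(1)]
          minus[OF mult[OF mult[OF inv f(2)] inv]]]) (use Suc.prems(3) in auto)
qed

text \<open>Here \<open>d\<close> sends the index of a function to the index of its derivative. For
  a family closed under differentiation the chain rule can be iterated by induction on
  \<open>k\<close> for all \<open>i\<close> at once: each step yields another member of the family
  times a derivative of \<open>u\<close>.\<close>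

lemma Ck_on_compose_real:
  fixes F :: "'i \<Rightarrow> real \<Rightarrow> real"
  assumes F: "\<And>i t. (F i has_real_derivative F (d i) t) (at t)"
  shows "open S \<Longrightarrow> Ck_on k S u \<Longrightarrow> Ck_on k S (\<lambda>x. F i (u x))"
proof (induction k arbitrary: i)
  case 0
  have "continuous_on UNIV (F i)"
    using F by (meson DERIV_isCont continuous_at_imp_continuous_on)
  then show ?case
    using 0 by (auto intro: continuous_on_compose2)
next
  case (Suc k)
  note u = Ck_on_SucD[OF Suc.prems(2)]
  note der = has_derivative_compose[OF u(1) F[unfolded has_field_derivative_def]]
  show ?case
    by (rule Ck_on_SucI[OF Suc.prems(1) der
          Ck_on_bilinear[OF bounded_bilinear_mult Suc.prems(1) Suc.IH[OF Suc.prems(1) u(3)] u(2)]])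
qed

section \<open>Smooth functions on arbitrary sets, handled through local extensions\<close>

lemma smooth_onE:
  assumes "smooth_on S f" "x \<in> S"
  obtains T g where "open T" "x \<in> T" "\<forall>k. Ck_on k T g" "\<forall>y\<in>S \<inter> T. g y = f y"
  using assms(1)[unfolded smooth_on_def, THEN bspec, OF assms(2)] by auto

lemma smooth_on_subset:
  assumes "smooth_on S f" "T \<subseteq> S"
  shows "smooth_on T f"
  unfolding smooth_on_def
proof
  fix x assume "x \<in> T"
  then have "x \<in> S" using assms(2) by auto
  obtain U g where "open U" "x \<in> U" "\<forall>k. Ck_on k U g" "\<forall>y\<in>S \<inter> U. g y = f y"
    using assms(1) \<open>x \<in> S\<close> by (rule smooth_onE)
  with assms(2) show "\<exists>U g. open U \<and> x \<in> U \<and> (\<forall>k. Ck_on k U g) \<and> (\<forall>y\<in>T \<inter> U. g y = f y)"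
    by (intro exI[of _ U] exI[of _ g]) auto
qed

lemma smooth_on_cong: "(\<And>x. x \<in> S \<Longrightarrow> f x = g x) \<Longrightarrow> smooth_on S f = smooth_on S g"
  unfolding smooth_on_def by simp

lemma smooth_on_local:
  assumes "\<And>x. x \<in> S \<Longrightarrow> \<exists>T. open T \<and> x \<in> T \<and> smooth_on (S \<inter> T) f"
  shows "smooth_on S f"
  unfolding smooth_on_def
proof
  fix x assume x: "x \<in> S"
  then obtain T where T: "open T" "x \<in> T" "smooth_on (S \<inter> T) f"
    using assms by auto
  have xT: "x \<in> S \<inter> T" using x T(2) by simp
  obtain T' g where T': "open T'" "x \<in> T'" "\<forall>k. Ck_on k T' g"
    "\<forall>y\<in>S \<inter> T \<inter> T'. g y = f y"
    using T(3) xT by (rule smooth_onE)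
  have "Ck_on k (T \<inter> T') g" for k
    using T'(3) by (auto intro: Ck_on_subset[of _ T'])
  with T T' show "\<exists>T g. open T \<and> x \<in> T \<and> (\<forall>k. Ck_on k T g) \<and> (\<forall>y\<in>S \<inter> T. g y = f y)"
    by (intro exI[of _ "T \<inter> T'"] exI[of _ g]) auto
qed

text \<open>An operation that preserves every class \<open>Ck_on k\<close> on open sets can be
  applied to the local extensions of \<open>f\<close>. This carries the rules for open sets over to
  arbitrary \<open>S\<close>.\<close>

lemma smooth_on_map:
  fixes S :: "'v::euclidean_space set"
  assumes L: "\<And>k (T :: 'v set) g. open T \<Longrightarrow> Ck_on k T g \<Longrightarrow> Ck_on k T (\<lambda>x. L (g x))" and f: "smooth_on S f"
  shows "smooth_on S (\<lambda>x. L (f x))"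
  unfolding smooth_on_def
proof
  fix x assume x: "x \<in> S"
  obtain T g where T: "open T" "x \<in> T" "\<forall>k. Ck_on k T g" "\<forall>y\<in>S \<inter> T. g y = f y"
    using f x by (rule smooth_onE)
  have "Ck_on k T (\<lambda>x. L (g x))" for k
    using T(1,3) by (simp add: L)
  with T show "\<exists>T g. open T \<and> x \<in> T \<and> (\<forall>k. Ck_on k T g) \<and> (\<forall>y\<in>S \<inter> T. g y = L (f y))"
    by (intro exI[of _ T] exI[of _ "\<lambda>x. L (g x)"]) simp
qed

lemma smooth_on_map2:
  fixes S :: "'v::euclidean_space set"
  assumes B: "\<And>k (T :: 'v set) f g. open T \<Longrightarrow> Ck_on k T f \<Longrightarrow> Ck_on k T g \<Longrightarrow> Ck_on k T (\<lambda>x. B (f x) (g x))"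
    and f: "smooth_on S f" and g: "smooth_on S g"
  shows "smooth_on S (\<lambda>x. B (f x) (g x))"
  unfolding smooth_on_def
proof
  fix x assume x: "x \<in> S"
  obtain T f' where T: "open T" "x \<in> T" "\<forall>k. Ck_on k T f'" "\<forall>y\<in>S \<inter> T. f' y = f y"
    using f x by (rule smooth_onE)
  obtain T' g' where T': "open T'" "x \<in> T'" "\<forall>k. Ck_on k T' g'" "\<forall>y\<in>S \<inter> T'. g' y = g y"
    using g x by (rule smooth_onE)
  have "Ck_on k (T \<inter> T') (\<lambda>x. B (f' x) (g' x))" for k
    using T(1) T'(1) by (intro B open_Int Ck_on_subset[OF spec[OF T(3)]] Ck_on_subset[OF spec[OF T'(3)]]) auto
  with T T' show "\<exists>T h. open T \<and> x \<in> T \<and> (\<forall>k. Ck_on k T h) \<and> (\<forall>y\<in>S \<inter> T. h y = B (f y) (g y))"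
    by (intro exI[of _ "T \<inter> T'"] exI[of _ "\<lambda>x. B (f' x) (g' x)"]) (simp add: open_Int)
qed

lemma smooth_on_inverse:
  fixes f :: "'v::euclidean_space \<Rightarrow> 'k::real_normed_field"
  assumes f: "smooth_on S f" and nz: "\<And>x. x \<in> S \<Longrightarrow> f x \<noteq> 0"
  shows "smooth_on S (\<lambda>x. inverse (f x))"
  unfolding smooth_on_def
proof
  fix x assume x: "x \<in> S"
  obtain T g where T: "open T" "x \<in> T" "\<forall>k. Ck_on k T g" "\<forall>y\<in>S \<inter> T. g y = f y"
    using f x by (rule smooth_onE)
  \<comment> \<open>The extension \<open>g\<close> is nonzero on \<open>S \<inter> T\<close> but may
    vanish elsewhere in \<open>T\<close>; its zeros are removed before inverting.\<close>
  define T' where "T' = T \<inter> g -` (- {0})"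
  have "continuous_on T g"
    using spec[OF T(3), of 0] by simp
  then have "open T'"
    unfolding T'_def using T(1) continuous_open_preimage by blast
  moreover have "Ck_on k T' (\<lambda>x. inverse (g x))" for k
  proof (intro Ck_on_inverse \<open>open T'\<close> Ck_on_subset[OF spec[OF T(3)]])
  qed (auto simp: T'_def)
  moreover have "g x \<noteq> 0" using T(2,4) x nz by simp
  ultimately show "\<exists>T h. open T \<and> x \<in> T \<and> (\<forall>k. Ck_on k T h) \<and> (\<forall>y\<in>S \<inter> T. h y = inverse (f y))"
    using T(2,4) by (intro exI[of _ "T'"] exI[of _ "\<lambda>x. inverse (g x)"]) (simp add: T'_def)
qed

text \<open>The derivatives of \<open>exp (- 1 / t)\<close> stay within this family, which is therefore smooth at \<open>0\<close> too.\<close>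

definition flat_exp :: "real poly \<Rightarrow> real \<Rightarrow> real" where
  "flat_exp p t = (if 0 < t then poly p (inverse t) * exp (- inverse t) else 0)"

lemma poly_times_exp_minus_tendsto: "((\<lambda>y::real. poly p y * exp (- y)) \<longlongrightarrow> 0) at_top"
proof -
  have "((\<lambda>y. \<Sum>i\<le>degree p. coeff p i * (y ^ i / exp y)) \<longlongrightarrow> (\<Sum>i\<le>degree p. coeff p i * 0)) at_top"
    by (intro tendsto_sum tendsto_mult tendsto_const tendsto_power_div_exp_0)
  then show ?thesis
    by (simp add: poly_altdef sum_distrib_right exp_minus divide_inverse mult.assoc)
qed

text \<open>With \<open>y = inverse t\<close> one has \<open>dy/dt = - y^2\<close>, so for positive
  \<open>t\<close> the derivative of \<open>p(y) exp(-y)\<close> is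
  \<open>y^2 (p(y) - p'(y)) exp(-y)\<close>; the factor \<open>[:0, 0, 1:]\<close> is the polynomial
  \<open>y^2\<close>. At \<open>0\<close> the exponential decay beats every polynomial.\<close>

lemma flat_exp_has_derivative:
  "(flat_exp p has_real_derivative flat_exp ([:0, 0, 1:] * (p - pderiv p)) t) (at t)"
proof -
  let ?q = "[:0, 0, 1:] * (p - pderiv p)"
  consider "t < 0" | "0 < t" | "t = 0" by linarith
  then show ?thesis
  proof cases
    case 1
    have "((\<lambda>_. 0) has_real_derivative 0) (at t)" by simp
    then have "(flat_exp p has_real_derivative 0) (at t)"
      by (rule has_field_derivative_transform_within_open[where S = "{..<0}"])
        (use 1 in \<open>auto simp: flat_exp_def\<close>)
    then show ?thesis using 1 by (simp add: flat_exp_def)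
  next
    case 2
    have "((\<lambda>t. poly p (inverse t) * exp (- inverse t)) has_real_derivative
        poly ?q (inverse t) * exp (- inverse t)) (at t)"
      using 2
      by (auto intro!: derivative_eq_intros DERIV_chain'[OF _ poly_DERIV]
          simp: field_simps power2_eq_square)
    then have "(flat_exp p has_real_derivative poly ?q (inverse t) * exp (- inverse t)) (at t)"
      by (rule has_field_derivative_transform_within_open[where S = "{0<..}"])
        (use 2 in \<open>auto simp: flat_exp_def\<close>)
    then show ?thesis using 2 by (simp add: flat_exp_def)
  next
    case 3
    \<comment> \<open>The difference quotient at \<open>0\<close> from the right divides by
      \<open>t\<close>, which multiplies the polynomial by \<open>y\<close> and so turns
      \<open>p\<close> into \<open>pCons 0 p\<close>.\<close>
    have "((\<lambda>t. poly (pCons 0 p) (inverse t) * exp (- inverse t)) \<longlongrightarrow> 0) (at_right 0)"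
      using filterlim_compose[OF poly_times_exp_minus_tendsto filterlim_inverse_at_top_right] .
    then have "((\<lambda>t. flat_exp p t / t) \<longlongrightarrow> 0) (at_right 0)"
      by (rule Lim_transform_eventually)
        (auto simp: flat_exp_def eventually_at_filter field_simps)
    moreover have "((\<lambda>t. flat_exp p t / t) \<longlongrightarrow> 0) (at_left 0)"
      by (rule Lim_transform_eventually[of "\<lambda>_. 0"])
        (auto simp: flat_exp_def eventually_at_filter)
    ultimately have "((\<lambda>t. flat_exp p t / t) \<longlongrightarrow> 0) (at 0)"
      by (simp add: filterlim_split_at)
    then show ?thesis
      using 3 by (simp add: has_field_derivative_iff flat_exp_def)
  qed
qed

text \<open>An instance of the chain rule for families closed under differentiation, with
  polynomials as indices.\<close>

lemma smooth_on_flat_exp: "smooth_on S u \<Longrightarrow> smooth_on S (\<lambda>x. flat_exp p (u x))"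
  by (rule smooth_on_map) (rule Ck_on_compose_real[where F = flat_exp, OF flat_exp_has_derivative])

section \<open>Smooth functions on manifolds with corners\<close>

locale corner_manifold =
  fixes M :: "('a::{t2_space,second_countable_topology}, 'n::finite) manifold"
  assumes atlas: "corner_atlas M"
begin

lemma chart:
  assumes "(V, K, \<phi>) \<in> charts M"
  shows "open V" "openin (top_of_set (corner_model (directions M) K)) (\<phi> ` V)"
    "homeomorphism V (\<phi> ` V) \<phi> (inv_into V \<phi>)"
  using atlas assms unfolding corner_atlas_def by blast+

lemma chart_inv: "(V, K, \<phi>) \<in> charts M \<Longrightarrow> p \<in> V \<Longrightarrow> inv_into V \<phi> (\<phi> p) = p"
  using chart(3) homeomorphism_apply1 by metis

lemma chart_at: obtains V K \<phi> where "(V, K, \<phi>) \<in> charts M" "p \<in> V"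
proof -
  have "p \<in> (\<Union>(U, K, \<phi>)\<in>charts M. U)"
    using atlas unfolding corner_atlas_def by simp
  then show ?thesis using that by auto
qed

lemma smooth_funI:
  "(\<And>V K \<phi>. (V, K, \<phi>) \<in> charts M \<Longrightarrow> smooth_on (\<phi> ` (U \<inter> V)) (\<lambda>x. f (inv_into V \<phi> x))) \<Longrightarrow>
    smooth_fun M U f"
  unfolding smooth_fun_def by (auto simp: o_def)

lemma smooth_funD:
  "smooth_fun M U f \<Longrightarrow> (V, K, \<phi>) \<in> charts M \<Longrightarrow> smooth_on (\<phi> ` (U \<inter> V)) (\<lambda>x. f (inv_into V \<phi> x))"
  unfolding smooth_fun_def by (auto simp: o_def)

lemma smooth_fun_cong:
  assumes "smooth_fun M U f" "\<And>p. p \<in> U \<Longrightarrow> f p = g p"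
  shows "smooth_fun M U g"
proof (rule smooth_funI)
  fix V K \<phi> assume c: "(V, K, \<phi>) \<in> charts M"
  show "smooth_on (\<phi> ` (U \<inter> V)) (\<lambda>x. g (inv_into V \<phi> x))"
    using smooth_funD[OF assms(1) c] assms(2) chart_inv[OF c]
    by (subst smooth_on_cong[where g = "\<lambda>x. f (inv_into V \<phi> x)"]) auto
qed

lemma smooth_fun_subset: "smooth_fun M U f \<Longrightarrow> V \<subseteq> U \<Longrightarrow> smooth_fun M V f"
  by (intro smooth_funI) (auto intro: smooth_on_subset[OF smooth_funD])

text \<open>Each chart tests smoothness on a subset of its coordinate space, so the neighbourhood
  \<open>G\<close> in the manifold has to be replaced by an ambient open set of coordinates. This
  works because a chart is a homeomorphism onto its image.\<close>

lemma smooth_fun_local: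
  assumes "\<And>p. p \<in> U \<Longrightarrow> \<exists>G. open G \<and> p \<in> G \<and> smooth_fun M (U \<inter> G) f"
  shows "smooth_fun M U f"
proof (intro smooth_funI smooth_on_local)
  fix V K \<phi> x assume c: "(V, K, \<phi>) \<in> charts M" and "x \<in> \<phi> ` (U \<inter> V)"
  then obtain p where p: "p \<in> U" "p \<in> V" "x = \<phi> p" by auto
  obtain G where G: "open G" "p \<in> G" "smooth_fun M (U \<inter> G) f"
    using assms[OF p(1)] by auto
  have "openin (top_of_set V) (V \<inter> G)"
    using G(1) by (simp add: openin_open_Int)
  then have "openin (top_of_set (\<phi> ` V)) (\<phi> ` (V \<inter> G))"
    using homeomorphism_imp_open_map[OF chart(3)[OF c]] by simp
  then obtain T where T: "open T" "\<phi> ` (V \<inter> G) = \<phi> ` V \<inter> T"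
    unfolding openin_open by auto
  have "\<phi> ` (U \<inter> V) \<inter> T \<subseteq> \<phi> ` ((U \<inter> G) \<inter> V)"
  proof
    fix y assume y: "y \<in> \<phi> ` (U \<inter> V) \<inter> T"
    then obtain q where q: "q \<in> U" "q \<in> V" "y = \<phi> q" by auto
    then have "y \<in> \<phi> ` (V \<inter> G)" using y T(2) by auto
    then have "q \<in> G" using q(2,3) chart_inv[OF c] by (metis IntE imageE)
    with q show "y \<in> \<phi> ` ((U \<inter> G) \<inter> V)" by auto
  qed
  with smooth_funD[OF G(3) c] have "smooth_on (\<phi> ` (U \<inter> V) \<inter> T) (\<lambda>x. f (inv_into V \<phi> x))"
    by (rule smooth_on_subset)
  moreover have "x \<in> T" using T(2) p G(2) by auto
  ultimately show "\<exists>T. open T \<and> x \<in> T \<and> smooth_on (\<phi> ` (U \<inter> V) \<inter> T) (\<lambda>x. f (inv_into V \<phi> x))"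
    using T(1) by auto
qed

lemma smooth_fun_const: "smooth_fun M U (\<lambda>p. c)"
proof (rule smooth_funI)
  fix V :: "'a set" and \<phi> :: "'a \<Rightarrow> real ^ 'n"
  show "smooth_on (\<phi> ` (U \<inter> V)) (\<lambda>x. c)"
    unfolding smooth_on_def
    by (intro ballI exI[of _ UNIV] exI[of _ "\<lambda>x. c"]) (simp add: Ck_on_const)
qed

lemma smooth_fun_map2:
  assumes B: "\<And>k (T :: (real ^ 'n) set) f g.
      open T \<Longrightarrow> Ck_on k T f \<Longrightarrow> Ck_on k T g \<Longrightarrow> Ck_on k T (\<lambda>x. B (f x) (g x))"
    and f: "smooth_fun M U f" and g: "smooth_fun M U g"
  shows "smooth_fun M U (\<lambda>p. B (f p) (g p))"
proof (rule smooth_funI)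
  fix V K \<phi> assume c: "(V, K, \<phi>) \<in> charts M"
  show "smooth_on (\<phi> ` (U \<inter> V)) (\<lambda>x. B (f (inv_into V \<phi> x)) (g (inv_into V \<phi> x)))"
    by (rule smooth_on_map2[OF B smooth_funD[OF f c] smooth_funD[OF g c]])
qed

lemma smooth_fun_add: "smooth_fun M U f \<Longrightarrow> smooth_fun M U g \<Longrightarrow> smooth_fun M U (\<lambda>p. f p + g p)"
  by (rule smooth_fun_map2[OF Ck_on_add])

lemma smooth_fun_bilinear:
  assumes "bounded_bilinear B"
  shows "smooth_fun M U f \<Longrightarrow> smooth_fun M U g \<Longrightarrow> smooth_fun M U (\<lambda>p. B (f p) (g p))"
  by (rule smooth_fun_map2[OF Ck_on_bilinear[OF assms]])

lemma smooth_fun_linear: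
  assumes "bounded_linear L" "smooth_fun M U f"
  shows "smooth_fun M U (\<lambda>p. L (f p))"
proof (rule smooth_funI)
  fix V K \<phi> assume c: "(V, K, \<phi>) \<in> charts M"
  show "smooth_on (\<phi> ` (U \<inter> V)) (\<lambda>x. L (f (inv_into V \<phi> x)))"
    by (rule smooth_on_map[OF Ck_on_linear[OF assms(1)] smooth_funD[OF assms(2) c]])
qed

lemma smooth_fun_inverse:
  fixes f :: "'a \<Rightarrow> 'k::real_normed_field"
  assumes "smooth_fun M U f" "\<And>p. p \<in> U \<Longrightarrow> f p \<noteq> 0"
  shows "smooth_fun M U (\<lambda>p. inverse (f p))"
proof (rule smooth_funI)
  fix V K \<phi> assume c: "(V, K, \<phi>) \<in> charts M"
  show "smooth_on (\<phi> ` (U \<inter> V)) (\<lambda>x. inverse (f (inv_into V \<phi> x)))"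
    by (rule smooth_on_inverse[OF smooth_funD[OF assms(1) c]]) (use assms(2) chart_inv[OF c] in auto)
qed

lemma smooth_fun_flat_exp:
  assumes "smooth_fun M U f"
  shows "smooth_fun M U (\<lambda>p. flat_exp P (f p))"
proof (rule smooth_funI)
  fix V K \<phi> assume c: "(V, K, \<phi>) \<in> charts M"
  show "smooth_on (\<phi> ` (U \<inter> V)) (\<lambda>x. flat_exp P (f (inv_into V \<phi> x)))"
    by (rule smooth_on_flat_exp[OF smooth_funD[OF assms c]])
qed

lemmas smooth_fun_mult = smooth_fun_bilinear[OF bounded_bilinear_mult]

lemma smooth_fun_minus: "smooth_fun M U f \<Longrightarrow> smooth_fun M U (\<lambda>p. - f p)"
  by (rule smooth_fun_linear[OF bounded_linear_minus[OF bounded_linear_ident]])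

lemma smooth_fun_sum:
  "(\<And>i. i \<in> I \<Longrightarrow> smooth_fun M U (f i)) \<Longrightarrow> smooth_fun M U (\<lambda>p. \<Sum>i\<in>I. f i p)"
  by (induction I rule: infinite_finite_induct) (auto intro: smooth_fun_const smooth_fun_add)

text \<open>Seen in another chart, a coordinate map is a transition map, whose smoothness is part of
  the atlas.\<close>

lemma smooth_fun_chart:
  assumes "(V, K, \<phi>) \<in> charts M"
  shows "smooth_fun M V \<phi>"
proof (rule smooth_funI)
  fix V' K' \<phi>' assume "(V', K', \<phi>') \<in> charts M"
  then have "smooth_on (\<phi>' ` (V' \<inter> V)) (\<phi> \<circ> inv_into V' \<phi>')"
    using atlas assms unfolding corner_atlas_def by fast
  then show "smooth_on (\<phi>' ` (V \<inter> V')) (\<lambda>x. \<phi> (inv_into V' \<phi>' x))"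
    by (simp add: o_def Int_commute)
qed

lemma smooth_fun_zero_extension:
  assumes "open U" "closed C" "C \<subseteq> U" "smooth_fun M U f" "\<And>p. p \<notin> C \<Longrightarrow> f p = 0"
  shows "smooth_fun M UNIV f"
proof (rule smooth_fun_local)
  fix p
  show "\<exists>G. open G \<and> p \<in> G \<and> smooth_fun M (UNIV \<inter> G) f"
  proof (cases "p \<in> C")
    case True
    then show ?thesis using assms(1,3,4) by auto
  next
    case False
    have "smooth_fun M (- C) f"
      by (rule smooth_fun_cong[OF smooth_fun_const[of _ 0]]) (use assms(5) in auto)
    then show ?thesis using False assms(2) by (intro exI[of _ "- C"]) auto
  qed
qed

section \<open>Bump functions and finite covers\<close>

lemma closed_corner_model: "closed (corner_model J K)"
proof -
  have "corner_model J K = (\<Inter>i\<in>K. {x. 0 \<le> x $ i}) \<inter> (\<Inter>i\<in>- J. {x. x $ i = 0})"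
    by (auto simp: corner_model_def)
  also have "closed \<dots>"
    by (intro closed_Int closed_INT ballI closed_Collect_le closed_Collect_eq continuous_intros)
  finally show ?thesis .
qed

text \<open>In a chart, \<open>flat_exp 1 u\<close> with
  \<open>u = e^2 - |\<phi> q - \<phi> p|^2\<close> is positive exactly where \<open>\<phi> q\<close>
  lies in the open ball of radius \<open>e\<close> around \<open>\<phi> p\<close>. Inside the corner
  model the closed ball is compact, so its preimage \<open>C\<close> is compact, hence closed in a
  Hausdorff space, and extension by zero stays smooth.\<close>

lemma bump_function:
  assumes "open U" "p \<in> U"
  obtains b :: "'a \<Rightarrow> real" and G C where "smooth_fun M UNIV b" "open G" "p \<in> G" "\<forall>q\<in>G. 0 < b q"
    "closed C" "C \<subseteq> U" "\<forall>q. q \<notin> C \<longrightarrow> b q = 0"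
proof -
  obtain V K \<phi> where c: "(V, K, \<phi>) \<in> charts M" and pV: "p \<in> V" by (rule chart_at)
  let ?J = "corner_model (directions M) K"
  note hom = chart(3)[OF c]
  have "openin (top_of_set (\<phi> ` V)) (\<phi> ` (V \<inter> U))"
    using assms(1) by (intro homeomorphism_imp_open_map[OF hom]) (simp add: openin_open_Int)
  then have "openin (top_of_set ?J) (\<phi> ` (V \<inter> U))"
    using chart(2)[OF c] openin_trans by blast
  \<comment> \<open>The chart image is open only relative to the corner model, so the ball has to be
    intersected with the model; this treats interior and boundary points alike.\<close>
  then obtain e where e: "0 < e" "cball (\<phi> p) e \<inter> ?J \<subseteq> \<phi> ` (V \<inter> U)"
    using pV assms(2) unfolding openin_contains_cball by blast
  have VJ: "\<phi> ` V \<subseteq> ?J" using chart(2)[OF c] openin_imp_subset by blast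
  define C where "C = inv_into V \<phi> ` (cball (\<phi> p) e \<inter> ?J)"
  define u where "u = (\<lambda>q. e\<^sup>2 + - ((\<phi> q + - \<phi> p) \<bullet> (\<phi> q + - \<phi> p)))"
  \<comment> \<open>Outside \<open>V\<close> the value of \<open>\<phi>\<close> carries no
    information, so \<open>0\<close> is prescribed there.\<close>
  define b where "b = (\<lambda>q. if q \<in> V then flat_exp 1 (u q) else 0)"
  have u: "u q = e\<^sup>2 - (dist (\<phi> p) (\<phi> q))\<^sup>2" for q
    by (simp add: u_def dist_norm power2_norm_eq_inner inner_diff inner_commute)
  have "continuous_on (cball (\<phi> p) e \<inter> ?J) (inv_into V \<phi>)"
    using hom e(2) by (intro continuous_on_subset[OF homeomorphism_cont2[OF hom]]) auto
  then have "compact C"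
    unfolding C_def by (intro compact_continuous_image compact_Int_closed compact_cball closed_corner_model)
  then have C: "closed C" by (rule compact_imp_closed)
  have CV: "C \<subseteq> V \<inter> U"
    unfolding C_def using e(2) chart_inv[OF c] by fastforce
  have b0: "b q = 0" if "q \<notin> C" for q
  proof (cases "q \<in> V")
    case True
    have "\<phi> q \<notin> cball (\<phi> p) e"
      using that True VJ chart_inv[OF c True] unfolding C_def by (metis IntI image_eqI subsetD)
    then have "e\<^sup>2 < (dist (\<phi> p) (\<phi> q))\<^sup>2" using e(1) by (intro power_strict_mono) auto
    then show ?thesis using True by (simp add: b_def u flat_exp_def)
  qed (simp add: b_def)
  have "smooth_fun M V (\<lambda>q. flat_exp 1 (u q))"
    unfolding u_def
    by (intro smooth_fun_flat_exp smooth_fun_add smooth_fun_const smooth_fun_minus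
        smooth_fun_bilinear[OF bounded_bilinear_inner] smooth_fun_chart[OF c])
  then have "smooth_fun M V b"
    by (rule smooth_fun_cong) (simp add: b_def)
  then have "smooth_fun M UNIV b"
    using chart(1)[OF c] C CV b0 by (intro smooth_fun_zero_extension[of V C]) auto
  moreover have "open (V \<inter> \<phi> -` ball (\<phi> p) e)"
    using homeomorphism_cont1[OF hom] chart(1)[OF c] by (intro continuous_open_preimage) auto
  moreover have "0 < b q" if "q \<in> V \<inter> \<phi> -` ball (\<phi> p) e" for q
  proof -
    have "(dist (\<phi> p) (\<phi> q))\<^sup>2 < e\<^sup>2" using that by (intro power_strict_mono) auto
    with that show ?thesis by (simp add: b_def u flat_exp_def)
  qed
  ultimately show ?thesis
    using that[of b "V \<inter> \<phi> -` ball (\<phi> p) e" C] C CV b0 pV e(1) by auto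
qed

text \<open>Squares are summed because each bump will later enter both members of a dual pair of
  sections. The finite index set consists of the points whose positivity neighbourhoods form a
  finite subcover.\<close>

lemma bump_cover:
  assumes "compact (UNIV :: 'a set)" and U: "\<And>p. open (U p)" "\<And>p. p \<in> U p"
  obtains I :: "'a set" and b :: "'a \<Rightarrow> 'a \<Rightarrow> real" and C where "finite I"
    "\<And>i. smooth_fun M UNIV (b i)" "\<And>i. closed (C i)" "\<And>i. C i \<subseteq> U i"
    "\<And>i q. q \<notin> C i \<Longrightarrow> b i q = 0" "\<And>q. 0 < (\<Sum>i\<in>I. (b i q)\<^sup>2)"
proof -
  \<comment> \<open>Bump function, positivity neighbourhood and closed set are packed into one
    triple \<open>(b, G, C)\<close>, so that a single choice selects all three for every
    point.\<close>
  let ?bump = "\<lambda>p t. smooth_fun M UNIV (fst t) \<and> open (fst (snd t)) \<and> p \<in> fst (snd t) \<and>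
    (\<forall>q\<in>fst (snd t). (0::real) < fst t q) \<and> closed (snd (snd t)) \<and> snd (snd t) \<subseteq> U p \<and>
    (\<forall>q. q \<notin> snd (snd t) \<longrightarrow> fst t q = 0)"
  have "\<forall>p. \<exists>t. ?bump p t"
  proof
    fix p
    obtain b :: "'a \<Rightarrow> real" and G C where "smooth_fun M UNIV b" "open G" "p \<in> G" "\<forall>q\<in>G. 0 < b q"
      "closed C" "C \<subseteq> U p" "\<forall>q. q \<notin> C \<longrightarrow> b q = 0"
      using U by (rule bump_function)
    then show "\<exists>t. ?bump p t"
      by (intro exI[of _ "(b, G, C)"]) simp
  qed
  then obtain t where "\<forall>p. ?bump p (t p)"
    by (rule choice[THEN exE])
  then have t: "smooth_fun M UNIV (fst (t p))" "open (fst (snd (t p)))" "p \<in> fst (snd (t p))"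
    "q \<in> fst (snd (t p)) \<Longrightarrow> 0 < fst (t p) q" "closed (snd (snd (t p)))" "snd (snd (t p)) \<subseteq> U p"
    "q \<notin> snd (snd (t p)) \<Longrightarrow> fst (t p) q = 0" for p q
    by auto
  have "UNIV \<subseteq> (\<Union>i\<in>UNIV. fst (snd (t i)))" using t(3) by auto
  with assms(1) t(2) obtain I where I: "I \<subseteq> UNIV" "finite I" "UNIV \<subseteq> (\<Union>i\<in>I. fst (snd (t i)))"
    by (rule compactE_image)
  show ?thesis
  proof (rule that[of I "\<lambda>p. fst (t p)" "\<lambda>p. snd (snd (t p))"])
    fix q
    obtain i where i: "i \<in> I" "q \<in> fst (snd (t i))" using I(3) by auto
    then have "0 < (fst (t i) q)\<^sup>2" using t(4)[OF i(2)] by simp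
    then show "0 < (\<Sum>i\<in>I. (fst (t i) q)\<^sup>2)" using I(2) i(1) by (intro sum_pos2) auto
  qed (use t I(2) in auto)
qed

end

section \<open>Smooth sections and dual pairs of generating sections\<close>

locale smooth_bundle = corner_manifold M
  for M :: "('a::{t2_space,second_countable_topology}, 'n::finite) manifold" +
  fixes E :: "('a, 'k::real_normed_field, 'v::ab_group_add) vbundle"
  assumes is_bundle: "vector_bundle M E"
begin

sublocale vs: vector_space "scal E"
  using is_bundle by (simp add: vector_bundle_def)

abbreviation smooth_section :: "'a set \<Rightarrow> ('a \<Rightarrow> 'v) \<Rightarrow> bool" where
  "smooth_section \<equiv> smooth_local_section M E"

lemma fibre_subspace: "vs.subspace (fibre E p)"
  using is_bundle by (simp add: vector_bundle_def)

lemmas fibre_zero = vs.subspace_0[OF fibre_subspace]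
  and fibre_add = vs.subspace_add[OF fibre_subspace]
  and fibre_diff = vs.subspace_diff[OF fibre_subspace]
  and fibre_scale = vs.subspace_scale[OF fibre_subspace]
  and fibre_sum = vs.subspace_sum[OF fibre_subspace]

lemma frame_at: obtains V r s where "(V, r, s) \<in> frames E" "p \<in> V"
proof -
  have "p \<in> (\<Union>(U, r, s)\<in>frames E. U)"
    using is_bundle unfolding vector_bundle_def by simp
  then show ?thesis using that by auto
qed

lemma frame:
  assumes "(V, r, s) \<in> frames E"
  shows "open V" "\<And>i. i < r \<Longrightarrow> smooth_section V (s i)"
    "\<And>p. p \<in> V \<Longrightarrow> inj_on (\<lambda>i. s i p) {..<r}"
    "\<And>p. p \<in> V \<Longrightarrow> vs.independent ((\<lambda>i. s i p) ` {..<r})"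
    "\<And>p. p \<in> V \<Longrightarrow> vs.span ((\<lambda>i. s i p) ` {..<r}) = fibre E p"
proof -
  have "local_frame M E (V, r, s)"
    using is_bundle assms unfolding vector_bundle_def by simp
  then show "open V" "\<And>i. i < r \<Longrightarrow> smooth_section V (s i)"
    "\<And>p. p \<in> V \<Longrightarrow> inj_on (\<lambda>i. s i p) {..<r}"
    "\<And>p. p \<in> V \<Longrightarrow> vs.independent ((\<lambda>i. s i p) ` {..<r})"
    "\<And>p. p \<in> V \<Longrightarrow> vs.span ((\<lambda>i. s i p) ` {..<r}) = fibre E p"
    unfolding local_frame_def by simp_all
qed

lemma frame_coords_unique:
  assumes f: "(V, r, s) \<in> frames E" "p \<in> V"
    and eq: "(\<Sum>i<r. scal E (c i) (s i p)) = (\<Sum>i<r. scal E (d i) (s i p))" and "i < r"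
  shows "c i = d i"
proof -
  let ?S = "(\<lambda>i. s i p) ` {..<r}" and ?inv = "inv_into {..<r} (\<lambda>i. s i p)"
  note inj = frame(3)[OF f]
  \<comment> \<open>Linear independence speaks of coefficients indexed by vectors; injectivity of
    the frame at \<open>p\<close> lets \<open>?inv\<close> translate between vectors and
    indices.\<close>
  have "(\<Sum>v\<in>?S. scal E (c (?inv v) - d (?inv v)) v) = (\<Sum>i<r. scal E (c i - d i) (s i p))"
    by (subst sum.reindex[OF inj]) (auto intro!: sum.cong simp: inv_into_f_f[OF inj])
  also have "\<dots> = 0"
    using eq by (simp add: vs.scale_left_diff_distrib sum_subtractf)
  finally have "c (?inv (s i p)) - d (?inv (s i p)) = 0"
    using vs.independentD[OF frame(4)[OF f], of ?S "\<lambda>v. c (?inv v) - d (?inv v)" "s i p"] \<open>i < r\<close>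
    by simp
  then show ?thesis using inv_into_f_f[OF inj] \<open>i < r\<close> by simp
qed

lemma section_fibre: "smooth_section U \<sigma> \<Longrightarrow> p \<in> U \<Longrightarrow> \<sigma> p \<in> fibre E p"
  by (simp add: smooth_local_section_def)

lemma section_coords:
  assumes "smooth_section U \<sigma>" "(V, r, s) \<in> frames E"
  obtains c where "\<forall>i<r. smooth_fun M (U \<inter> V) (c i)"
    "\<forall>p\<in>U \<inter> V. \<sigma> p = (\<Sum>i<r. scal E (c i p) (s i p))"
  using assms unfolding smooth_local_section_def by fast

lemma smooth_sectionI:
  assumes "\<And>p. p \<in> U \<Longrightarrow> \<sigma> p \<in> fibre E p"
    and "\<And>V r s. (V, r, s) \<in> frames E \<Longrightarrow> \<exists>c. (\<forall>i<r. smooth_fun M (U \<inter> V) (c i)) \<and>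
      (\<forall>p\<in>U \<inter> V. \<sigma> p = (\<Sum>i<r. scal E (c i p) (s i p)))"
  shows "smooth_section U \<sigma>"
  unfolding smooth_local_section_def using assms by auto

lemma smooth_section_subset:
  assumes "smooth_section U \<sigma>" "V \<subseteq> U"
  shows "smooth_section V \<sigma>"
proof (rule smooth_sectionI)
  fix V' r s assume f: "(V', r, s) \<in> frames E"
  obtain c where "\<forall>i<r. smooth_fun M (U \<inter> V') (c i)"
    "\<forall>p\<in>U \<inter> V'. \<sigma> p = (\<Sum>i<r. scal E (c i p) (s i p))"
    using assms(1) f by (rule section_coords)
  with assms(2) show "\<exists>c. (\<forall>i<r. smooth_fun M (V \<inter> V') (c i)) \<and>
      (\<forall>p\<in>V \<inter> V'. \<sigma> p = (\<Sum>i<r. scal E (c i p) (s i p)))"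
    by (intro exI[of _ c]) (auto intro: smooth_fun_subset[of "U \<inter> V'"])
qed (use assms section_fibre in auto)

lemma smooth_section_cong:
  "smooth_section U \<sigma> \<Longrightarrow> (\<And>p. p \<in> U \<Longrightarrow> \<sigma> p = \<tau> p) \<Longrightarrow> smooth_section U \<tau>"
  by (simp add: smooth_local_section_def)

text \<open>For every frame, a smooth section must have coefficients that are smooth on all of
  \<open>U \<inter> V\<close>. Local coefficients glue to such functions because coordinates in a
  frame are unique.\<close>

lemma smooth_section_local:
  assumes "\<And>p. p \<in> U \<Longrightarrow> \<exists>G. open G \<and> p \<in> G \<and> smooth_section (U \<inter> G) \<sigma>"
  shows "smooth_section U \<sigma>"
proof (rule smooth_sectionI)
  show "\<sigma> p \<in> fibre E p" if "p \<in> U" for p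
    using assms[OF that] section_fibre that by auto
next
  fix V r s assume f: "(V, r, s) \<in> frames E"
  \<comment> \<open>The coefficients are chosen point by point with no regard to smoothness; for
    indices below \<open>r\<close> they are then forced to agree with the smooth local coefficients
    \<open>d\<close>.\<close>
  define c where "c = (\<lambda>i p. (SOME c. \<sigma> p = (\<Sum>i<r. scal E (c i) (s i p))) i)"
  have c: "\<sigma> p = (\<Sum>i<r. scal E (c i p) (s i p))" "\<exists>G. open G \<and> p \<in> G \<and> (\<forall>i<r. smooth_fun M (U \<inter> V \<inter> G) (c i))"
    if p: "p \<in> U \<inter> V" for p
  proof -
    obtain G where G: "open G" "p \<in> G" "smooth_section (U \<inter> G) \<sigma>"
      using assms p by auto
    obtain d where d: "\<forall>i<r. smooth_fun M (U \<inter> G \<inter> V) (d i)"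
      "\<forall>p\<in>U \<inter> G \<inter> V. \<sigma> p = (\<Sum>i<r. scal E (d i p) (s i p))"
      using G(3) f by (rule section_coords)
    have eq: "\<sigma> q = (\<Sum>i<r. scal E (c i q) (s i q))" if "q \<in> U \<inter> G \<inter> V" for q
      unfolding c_def by (rule someI[of _ "\<lambda>i. d i q"]) (use d(2) that in auto)
    show "\<sigma> p = (\<Sum>i<r. scal E (c i p) (s i p))"
      using eq p G(2) by simp
    have dc: "d i q = c i q" if "i < r" "q \<in> U \<inter> G \<inter> V" for i q
      using frame_coords_unique[OF f, of q "\<lambda>i. d i q" "\<lambda>i. c i q"] d(2) eq[OF that(2)] that by auto
    have "smooth_fun M (U \<inter> G \<inter> V) (c i)" if "i < r" for i
      by (rule smooth_fun_cong[of _ "d i"]) (use that d(1) dc in auto)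
    then show "\<exists>G. open G \<and> p \<in> G \<and> (\<forall>i<r. smooth_fun M (U \<inter> V \<inter> G) (c i))"
      using G(1,2) by (intro exI[of _ G]) (simp add: Int_ac)
  qed
  show "\<exists>c. (\<forall>i<r. smooth_fun M (U \<inter> V) (c i)) \<and>
      (\<forall>p\<in>U \<inter> V. \<sigma> p = (\<Sum>i<r. scal E (c i p) (s i p)))"
  proof (intro exI[of _ c] conjI allI impI ballI)
    fix i assume "i < r"
    then show "smooth_fun M (U \<inter> V) (c i)"
      using c(2) by (intro smooth_fun_local) auto
  qed (rule c(1))
qed

lemma smooth_section_zero: "smooth_section U (\<lambda>p. 0)"
  by (intro smooth_sectionI exI[of _ "\<lambda>i p. 0"]) (auto intro: smooth_fun_const fibre_zero)

lemma smooth_section_add: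
  assumes "smooth_section U \<sigma>" "smooth_section U \<tau>"
  shows "smooth_section U (\<lambda>p. \<sigma> p + \<tau> p)"
proof (rule smooth_sectionI)
  fix V r s assume f: "(V, r, s) \<in> frames E"
  obtain c where c: "\<forall>i<r. smooth_fun M (U \<inter> V) (c i)"
    "\<forall>p\<in>U \<inter> V. \<sigma> p = (\<Sum>i<r. scal E (c i p) (s i p))"
    using assms(1) f by (rule section_coords)
  obtain d where d: "\<forall>i<r. smooth_fun M (U \<inter> V) (d i)"
    "\<forall>p\<in>U \<inter> V. \<tau> p = (\<Sum>i<r. scal E (d i p) (s i p))"
    using assms(2) f by (rule section_coords)
  show "\<exists>c. (\<forall>i<r. smooth_fun M (U \<inter> V) (c i)) \<and>
      (\<forall>p\<in>U \<inter> V. \<sigma> p + \<tau> p = (\<Sum>i<r. scal E (c i p) (s i p)))"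
    by (rule exI[of _ "\<lambda>i p. c i p + d i p"])
      (simp add: c d smooth_fun_add vs.scale_left_distrib sum.distrib)
qed (use assms section_fibre fibre_add in auto)

lemma smooth_section_scale:
  assumes "smooth_fun M U f" "smooth_section U \<sigma>"
  shows "smooth_section U (\<lambda>p. scal E (f p) (\<sigma> p))"
proof (rule smooth_sectionI)
  fix V r s assume f: "(V, r, s) \<in> frames E"
  obtain c where c: "\<forall>i<r. smooth_fun M (U \<inter> V) (c i)"
    "\<forall>p\<in>U \<inter> V. \<sigma> p = (\<Sum>i<r. scal E (c i p) (s i p))"
    using assms(2) f by (rule section_coords)
  have "smooth_fun M (U \<inter> V) f"
    using assms(1) by (rule smooth_fun_subset) simp
  then show "\<exists>c. (\<forall>i<r. smooth_fun M (U \<inter> V) (c i)) \<and>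
      (\<forall>p\<in>U \<inter> V. scal E (f p) (\<sigma> p) = (\<Sum>i<r. scal E (c i p) (s i p)))"
    by (intro exI[of _ "\<lambda>i p. f p * c i p"]) (simp add: c smooth_fun_mult vs.scale_sum_right)
qed (use assms section_fibre fibre_scale in auto)

lemma smooth_section_sum:
  "(\<And>i. i \<in> I \<Longrightarrow> smooth_section U (\<sigma> i)) \<Longrightarrow> smooth_section U (\<lambda>p. \<Sum>i\<in>I. \<sigma> i p)"
  by (induction I rule: infinite_finite_induct) (auto intro: smooth_section_zero smooth_section_add)

lemma smooth_section_zero_extension:
  assumes "open U" "closed C" "C \<subseteq> U" "smooth_section U \<sigma>" "\<And>p. p \<notin> C \<Longrightarrow> \<sigma> p = 0"
  shows "smooth_section UNIV \<sigma>"
proof (rule smooth_section_local)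
  fix p
  show "\<exists>G. open G \<and> p \<in> G \<and> smooth_section (UNIV \<inter> G) \<sigma>"
  proof (cases "p \<in> C")
    case True
    then show ?thesis using assms(1,3,4) by auto
  next
    case False
    have "smooth_section (- C) \<sigma>"
      by (rule smooth_section_cong[OF smooth_section_zero]) (use assms(5) in auto)
    then show ?thesis using False assms(2) by (intro exI[of _ "- C"]) auto
  qed
qed

end

text \<open>Common setting for a Riemannian metric (\<open>conj\<close> the identity) and a
  Hermitian one (\<open>conj\<close> complex conjugation). A general scalar field has no order, so
  \<open>definite\<close> takes the place of positivity and \<open>orthogonal_sym\<close> that of
  symmetry; \<open>conj_of_real\<close> lets real cut-off functions be pulled unchanged out of the
  second argument.\<close>

locale metric_bundle = smooth_bundle M E
  for M :: "('a::{t2_space,second_countable_topology}, 'n::finite) manifold"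
    and E :: "('a, 'k::real_normed_field, 'v::ab_group_add) vbundle" +
  fixes conj :: "'k \<Rightarrow> 'k" and h :: "'a \<Rightarrow> 'v \<Rightarrow> 'v \<Rightarrow> 'k"
  assumes conj_linear: "bounded_linear conj" and conj_of_real: "conj (of_real t) = of_real t"
    and add_left: "\<lbrakk>v \<in> fibre E p; w \<in> fibre E p; u \<in> fibre E p\<rbrakk> \<Longrightarrow> h p (v + w) u = h p v u + h p w u"
    and add_right: "\<lbrakk>v \<in> fibre E p; w \<in> fibre E p; u \<in> fibre E p\<rbrakk> \<Longrightarrow> h p u (v + w) = h p u v + h p u w"
    and scale_left: "\<lbrakk>v \<in> fibre E p; u \<in> fibre E p\<rbrakk> \<Longrightarrow> h p (scal E z v) u = z * h p v u"
    and scale_right: "\<lbrakk>v \<in> fibre E p; u \<in> fibre E p\<rbrakk> \<Longrightarrow> h p u (scal E z v) = conj z * h p u v"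
    and orthogonal_sym: "\<lbrakk>v \<in> fibre E p; u \<in> fibre E p; h p u v = 0\<rbrakk> \<Longrightarrow> h p v u = 0"
    and definite: "\<lbrakk>v \<in> fibre E p; v \<noteq> 0\<rbrakk> \<Longrightarrow> h p v v \<noteq> 0"
    and smooth_frames: "\<lbrakk>(U, r, s) \<in> frames E; i < r; j < r\<rbrakk> \<Longrightarrow> smooth_fun M U (\<lambda>p. h p (s i p) (s j p))"
begin

section \<open>Expansion and smoothness of the metric\<close>

lemma zero_left: "u \<in> fibre E p \<Longrightarrow> h p 0 u = 0"
  using scale_left[of 0 p u 0] fibre_zero by simp

lemma zero_right: "u \<in> fibre E p \<Longrightarrow> h p u 0 = 0"
  using add_right[of 0 p 0 u] fibre_zero by simp

lemma sum_left:
  "u \<in> fibre E p \<Longrightarrow> (\<And>i. i \<in> I \<Longrightarrow> v i \<in> fibre E p) \<Longrightarrow> h p (\<Sum>i\<in>I. v i) u = (\<Sum>i\<in>I. h p (v i) u)"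
  by (induction I rule: infinite_finite_induct) (auto simp: zero_left add_left fibre_sum)

lemma sum_right:
  "u \<in> fibre E p \<Longrightarrow> (\<And>i. i \<in> I \<Longrightarrow> v i \<in> fibre E p) \<Longrightarrow> h p u (\<Sum>i\<in>I. v i) = (\<Sum>i\<in>I. h p u (v i))"
  by (induction I rule: infinite_finite_induct) (auto simp: zero_right add_right fibre_sum)

lemma lincomb_left:
  assumes "u \<in> fibre E p" "\<And>i. i \<in> I \<Longrightarrow> v i \<in> fibre E p"
  shows "h p (\<Sum>i\<in>I. scal E (c i) (v i)) u = (\<Sum>i\<in>I. c i * h p (v i) u)"
  using assms by (simp add: sum_left fibre_scale scale_left)

lemma lincomb_right:
  assumes "u \<in> fibre E p" "\<And>i. i \<in> I \<Longrightarrow> v i \<in> fibre E p"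
  shows "h p u (\<Sum>i\<in>I. scal E (c i) (v i)) = (\<Sum>i\<in>I. conj (c i) * h p u (v i))"
  using assms by (simp add: sum_right fibre_scale scale_right)

text \<open>Smoothness is given only on pairs of frame sections; both arguments are expanded in a
  local frame and the resulting local statements are glued.\<close>

lemma smooth_metric:
  assumes "smooth_section U \<sigma>" "smooth_section U \<tau>"
  shows "smooth_fun M U (\<lambda>p. h p (\<sigma> p) (\<tau> p))"
proof (rule smooth_fun_local)
  fix p assume "p \<in> U"
  obtain V r s where f: "(V, r, s) \<in> frames E" and pV: "p \<in> V"
    by (rule frame_at)
  obtain c where c: "\<forall>i<r. smooth_fun M (U \<inter> V) (c i)"
    "\<forall>p\<in>U \<inter> V. \<sigma> p = (\<Sum>i<r. scal E (c i p) (s i p))"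
    using assms(1) f by (rule section_coords)
  obtain d where d: "\<forall>i<r. smooth_fun M (U \<inter> V) (d i)"
    "\<forall>p\<in>U \<inter> V. \<tau> p = (\<Sum>i<r. scal E (d i p) (s i p))"
    using assms(2) f by (rule section_coords)
  have s: "s i q \<in> fibre E q" if "i < r" "q \<in> V" for i q
    using section_fibre[OF frame(2)[OF f]] that by blast
  have "smooth_fun M (U \<inter> V) (\<lambda>p. \<Sum>i<r. \<Sum>j<r. c i p * (conj (d j p) * h p (s i p) (s j p)))"
    by (intro smooth_fun_sum smooth_fun_mult smooth_fun_linear[OF conj_linear]
        smooth_fun_subset[OF smooth_frames[OF f]]) (simp_all add: c d)
  then have "smooth_fun M (U \<inter> V) (\<lambda>p. h p (\<sigma> p) (\<tau> p))"
  proof (rule smooth_fun_cong)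
    fix q assume q: "q \<in> U \<inter> V"
    have "h q (\<sigma> q) (\<tau> q) = (\<Sum>i<r. c i q * h q (s i q) (\<tau> q))"
      unfolding bspec[OF c(2) q] using q s section_fibre[OF assms(2)] by (intro lincomb_left) auto
    also have "\<dots> = (\<Sum>i<r. c i q * (\<Sum>j<r. conj (d j q) * h q (s i q) (s j q)))"
      unfolding bspec[OF d(2) q] using q s
      by (intro sum.cong refl arg_cong[where f = "(*) _"] lincomb_right) auto
    finally have "h q (\<sigma> q) (\<tau> q) = (\<Sum>i<r. c i q * (\<Sum>j<r. conj (d j q) * h q (s i q) (s j q)))" .
    then show "(\<Sum>i<r. \<Sum>j<r. c i q * (conj (d j q) * h q (s i q) (s j q))) = h q (\<sigma> q) (\<tau> q)"
      by (simp add: sum_distrib_left)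
  qed
  then show "\<exists>G. open G \<and> p \<in> G \<and> smooth_fun M (U \<inter> G) (\<lambda>p. h p (\<sigma> p) (\<tau> p))"
    using pV frame(1)[OF f] by auto
qed

lemma Gram_Schmidt:
  assumes f: "(V, r, s) \<in> frames E"
  shows "m \<le> r \<Longrightarrow> \<exists>e. (\<forall>i<m. smooth_section V (e i)) \<and>
    (\<forall>p\<in>V. (\<forall>i<m. e i p \<noteq> 0) \<and> (\<forall>i<m. \<forall>j<m. i \<noteq> j \<longrightarrow> h p (e i p) (e j p) = 0) \<and>
      vs.span ((\<lambda>i. e i p) ` {..<m}) = vs.span ((\<lambda>i. s i p) ` {..<m}))"
proof (induction m)
  case 0
  then show ?case by simp
next
  case (Suc m)
  then obtain e where e: "\<And>i. i < m \<Longrightarrow> smooth_section V (e i)"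
    "\<And>p i. p \<in> V \<Longrightarrow> i < m \<Longrightarrow> e i p \<noteq> 0"
    "\<And>p i j. p \<in> V \<Longrightarrow> i < m \<Longrightarrow> j < m \<Longrightarrow> i \<noteq> j \<Longrightarrow> h p (e i p) (e j p) = 0"
    "\<And>p. p \<in> V \<Longrightarrow> vs.span ((\<lambda>i. e i p) ` {..<m}) = vs.span ((\<lambda>i. s i p) ` {..<m})"
    by (metis Suc_leD)
  have sm: "smooth_section V (s m)" using frame(2)[OF f] Suc.prems by simp
  have eF: "e i p \<in> fibre E p" if "i < m" "p \<in> V" for i p
    using section_fibre e(1) that by blast
  have smF: "s m p \<in> fibre E p" if "p \<in> V" for p
    using section_fibre[OF sm that] .
  \<comment> \<open>Minus the projection coefficient of \<open>s m\<close> onto \<open>e i\<close>;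
    the denominator never vanishes, by \<open>definite\<close>, so the coefficient is
    smooth.\<close>
  define c where "c = (\<lambda>i p. - (h p (s m p) (e i p) * inverse (h p (e i p) (e i p))))"
  define x where "x = (\<lambda>p. s m p + (\<Sum>i<m. scal E (c i p) (e i p)))"
  have smooth_x: "smooth_section V x"
    unfolding x_def c_def
    by (intro smooth_section_add sm smooth_section_sum smooth_section_scale e(1) smooth_fun_minus
        smooth_fun_mult smooth_metric smooth_fun_inverse definite eF e(2)) auto
  have lin: "(\<Sum>i<m. scal E (c i p) (e i p)) \<in> vs.span ((\<lambda>i. e i p) ` {..<m})" for p
    by (intro vs.span_sum vs.span_scale vs.span_base) auto
  have x0: "x p \<noteq> 0" if p: "p \<in> V" for p
  proof
    assume "x p = 0"
    then have "s m p = - (\<Sum>i<m. scal E (c i p) (e i p))"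
      unfolding x_def using eq_neg_iff_add_eq_0 by blast
    then have "s m p \<in> vs.span ((\<lambda>i. s i p) ` {..<m})"
      using vs.span_neg[OF lin[of p]] e(4)[OF p] by simp
    moreover have "(\<lambda>i. s i p) ` {..<m} \<subseteq> (\<lambda>i. s i p) ` {..<r} - {s m p}"
      using inj_onD[OF frame(3)[OF f p], of _ m] Suc.prems by fastforce
    ultimately have "s m p \<in> vs.span ((\<lambda>i. s i p) ` {..<r} - {s m p})"
      using vs.span_mono by blast
    then show False
      using frame(4)[OF f p] Suc.prems unfolding vs.dependent_def by auto
  qed
  have orth: "h p (x p) (e j p) = 0" if p: "p \<in> V" and j: "j < m" for p j
  proof -
    have "h p (x p) (e j p) = h p (s m p) (e j p) + h p (\<Sum>i<m. scal E (c i p) (e i p)) (e j p)"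
      unfolding x_def using p j smF eF by (intro add_left fibre_sum fibre_scale) auto
    also have "h p (\<Sum>i<m. scal E (c i p) (e i p)) (e j p) = (\<Sum>i<m. c i p * h p (e i p) (e j p))"
      using p j eF by (intro lincomb_left) auto
    \<comment> \<open>Orthogonality of the earlier vectors leaves only the term with
      \<open>i = j\<close>.\<close>
    also have "(\<Sum>i<m. c i p * h p (e i p) (e j p)) = (\<Sum>i<m. if i = j then c j p * h p (e j p) (e j p) else 0)"
      using e(3)[OF p _ j] by (intro sum.cong) auto
    also have "\<dots> = - h p (s m p) (e j p)"
      using j definite[OF eF[OF j p] e(2)[OF p j]] by (simp add: c_def)
    finally show ?thesis by simp
  qed
  have orth': "h p (e j p) (x p) = 0" if p: "p \<in> V" and j: "j < m" for p j
    using orthogonal_sym[OF eF[OF j p] section_fibre[OF smooth_x p] orth[OF p j]] .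
  have span: "vs.span (insert (x p) ((\<lambda>i. e i p) ` {..<m})) = vs.span (insert (s m p) ((\<lambda>i. s i p) ` {..<m}))"
    if p: "p \<in> V" for p
  proof -
    \<comment> \<open>The new vector differs from \<open>s m p\<close> by a combination of the
      earlier ones, so adjoining either gives the same span.\<close>
    have "x p - s m p \<in> vs.span ((\<lambda>i. e i p) ` {..<m})"
      using lin by (simp add: x_def)
    then have "vs.span (insert (x p) ((\<lambda>i. e i p) ` {..<m})) = vs.span (insert (s m p) ((\<lambda>i. e i p) ` {..<m}))"
      by (rule vs.eq_span_insert_eq)
    also have "\<dots> = vs.span (insert (s m p) ((\<lambda>i. s i p) ` {..<m}))"
      by (simp add: vs.span_insert e(4)[OF p])
    finally show ?thesis .
  qed
  define e' where "e' = e(m := x)"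
  have e': "e' m = x" "\<And>i. i < m \<Longrightarrow> e' i = e i" by (auto simp: e'_def)
  show ?case
  proof (intro exI[of _ e'] conjI allI impI ballI)
    fix i p assume "i < Suc m"
    then show "smooth_section V (e' i)"
      using smooth_x e(1) e' by (cases "i = m") auto
  next
    fix i p assume "p \<in> V" "i < Suc m"
    then show "e' i p \<noteq> 0"
      using x0 e(2) e' by (cases "i = m") auto
  next
    fix i j p assume "p \<in> V" "i < Suc m" "j < Suc m" "i \<noteq> j"
    then show "h p (e' i p) (e' j p) = 0"
      using orth orth' e(3) e' by (cases "i = m"; cases "j = m") auto
  next
    fix p assume "p \<in> V"
    moreover have "(\<lambda>i. e' i p) ` {..<m} = (\<lambda>i. e i p) ` {..<m}"
      using e' by auto
    ultimately show "vs.span ((\<lambda>i. e' i p) ` {..<Suc m}) = vs.span ((\<lambda>i. s i p) ` {..<Suc m})"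
      using span by (simp add: lessThan_Suc e')
  qed
qed

text \<open>For an orthogonal frame \<open>e\<close> one takes \<open>Y = e\<close> and lets
  \<open>X\<close> be \<open>e\<close> divided by \<open>h e e\<close>; the missing normalisation is
  thus absorbed into \<open>X\<close>.\<close>

lemma local_dual_frames:
  "\<exists>V (r::nat) X Y. open V \<and> p \<in> V \<and> (\<forall>i<r. smooth_section V (X i) \<and> smooth_section V (Y i)) \<and>
    (\<forall>q\<in>V. \<forall>v\<in>fibre E q. v = (\<Sum>i<r. scal E (h q v (Y i q)) (X i q)))"
proof -
  obtain V r s where f: "(V, r, s) \<in> frames E" and pV: "p \<in> V"
    by (rule frame_at)
  obtain e where e: "\<And>i. i < r \<Longrightarrow> smooth_section V (e i)"
    "\<And>p i. p \<in> V \<Longrightarrow> i < r \<Longrightarrow> e i p \<noteq> 0"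
    "\<And>p i j. p \<in> V \<Longrightarrow> i < r \<Longrightarrow> j < r \<Longrightarrow> i \<noteq> j \<Longrightarrow> h p (e i p) (e j p) = 0"
    "\<And>p. p \<in> V \<Longrightarrow> vs.span ((\<lambda>i. e i p) ` {..<r}) = fibre E p"
    using Gram_Schmidt[OF f order_refl] frame(5)[OF f] by metis
  have eF: "e i q \<in> fibre E q" if "i < r" "q \<in> V" for i q
    using section_fibre e(1) that by blast
  let ?n = "\<lambda>i q. h q (e i q) (e i q)"
  define X where "X = (\<lambda>i q. scal E (inverse (?n i q)) (e i q))"
  have X: "smooth_section V (X i)" if "i < r" for i
    unfolding X_def using that
    by (intro smooth_section_scale smooth_fun_inverse smooth_metric e(1) definite eF e(2)) auto
  have "v = (\<Sum>i<r. scal E (h q v (e i q)) (X i q))" if q: "q \<in> V" and v: "v \<in> fibre E q" for q v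
  proof -
    let ?P = "\<lambda>v. (\<Sum>i<r. scal E (h q v (e i q)) (X i q))"
    have "v \<in> vs.span ((\<lambda>i. e i q) ` {..<r})" using e(4)[OF q] v by simp
    \<comment> \<open>The vectors reproduced by \<open>?P\<close> form a subspace, so it suffices to
      check the frame vectors.\<close>
    then have "v \<in> fibre E q \<and> v = ?P v"
    proof (rule vs.span_induct)
      show "vs.subspace {v. v \<in> fibre E q \<and> v = ?P v}"
      proof (rule vs.subspaceI)
        show "0 \<in> {v. v \<in> fibre E q \<and> v = ?P v}"
          by (simp add: fibre_zero zero_left eF q)
      next
        fix v w assume *: "v \<in> {v. v \<in> fibre E q \<and> v = ?P v}" "w \<in> {v. v \<in> fibre E q \<and> v = ?P v}"
        then have F: "v \<in> fibre E q" "w \<in> fibre E q" and eq: "?P v = v" "?P w = w" by auto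
        have "?P (v + w) = ?P v + ?P w"
          by (simp add: add_left eF q F vs.scale_left_distrib sum.distrib)
        then show "v + w \<in> {v. v \<in> fibre E q \<and> v = ?P v}" by (simp add: eq F fibre_add)
      next
        fix v z assume "v \<in> {v. v \<in> fibre E q \<and> v = ?P v}"
        then have F: "v \<in> fibre E q" and eq: "?P v = v" by auto
        have "?P (scal E z v) = scal E z (?P v)"
          by (simp add: scale_left eF q F vs.scale_sum_right)
        then show "scal E z v \<in> {v. v \<in> fibre E q \<and> v = ?P v}" by (simp add: eq F fibre_scale)
      qed
    next
      fix v assume "v \<in> (\<lambda>i. e i q) ` {..<r}"
      then obtain j where j: "j < r" "v = e j q" by auto
      have "?P v = (\<Sum>i<r. if i = j then e j q else 0)"
        unfolding j(2) X_def
      proof (intro sum.cong refl)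
        fix i assume "i \<in> {..<r}"
        then show "scal E (h q (e j q) (e i q)) (scal E (inverse (?n i q)) (e i q)) = (if i = j then e j q else 0)"
          using e(3)[OF q j(1), of i] definite[OF eF[OF j(1) q] e(2)[OF q j(1)]] by auto
      qed
      then show "v \<in> fibre E q \<and> v = ?P v" using j eF q by simp
    qed
    then show ?thesis by simp
  qed
  then have *: "\<forall>q\<in>V. \<forall>v\<in>fibre E q. v = (\<Sum>i<r. scal E (h q v (e i q)) (X i q))"
    by (intro ballI)
  show ?thesis
    by (rule exI[of _ V], rule exI[of _ r], rule exI[of _ X], rule exI[of _ e])
      (intro conjI allI impI frame(1)[OF f] pV e(1) X *)
qed

text \<open>A global frame need not exist, so local dual pairs are cut off by bumps and collected.
  With \<open>S\<close> the sum of the squared bumps, \<open>b a / S\<close> goes to the first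
  member and \<open>b a\<close> to the second; the patch of \<open>a\<close> then contributes
  \<open>(b a)^2 / S\<close> times \<open>v\<close>, and these weights add up to
  \<open>1\<close>.\<close>

lemma dual_generators:
  assumes "compact (UNIV :: 'a set)"
  obtains N :: nat and X Y where "\<forall>k<N. X k \<in> sections M E \<and> Y k \<in> sections M E"
    "\<forall>p. \<forall>v\<in>fibre E p. v = (\<Sum>k<N. scal E (h p v (Y k p)) (X k p))"
proof -
  let ?dual = "\<lambda>p (V, r::nat, X, Y). open V \<and> p \<in> V \<and>
    (\<forall>i<r. smooth_section V (X i) \<and> smooth_section V (Y i)) \<and>
    (\<forall>q\<in>V. \<forall>v\<in>fibre E q. v = (\<Sum>i<r. scal E (h q v (Y i q)) (X i q)))"
  have "\<forall>p. \<exists>t. ?dual p t"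
  proof
    fix p
    obtain V and r :: nat and X Y where "?dual p (V, r, X, Y)"
      using local_dual_frames[of p] by auto
    then show "\<exists>t. ?dual p t" by (rule exI[of "?dual p"])
  qed
  then obtain t where t: "\<forall>p. ?dual p (t p)"
    by (rule choice[THEN exE])
  define V r X Y where "V = (\<lambda>p. fst (t p))" and "r = (\<lambda>p. fst (snd (t p)))"
    and "X = (\<lambda>p. fst (snd (snd (t p))))" and "Y = (\<lambda>p. snd (snd (snd (t p))))"
  have dual: "?dual p (V p, r p, X p, Y p)" for p
    using spec[OF t, of p] by (simp add: V_def r_def X_def Y_def)
  have loc: "open (V p)" "p \<in> V p" "i < r p \<Longrightarrow> smooth_section (V p) (X p i)"
    "i < r p \<Longrightarrow> smooth_section (V p) (Y p i)" for p i
    using dual[of p] by simp_all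
  have expand: "(\<Sum>i<r p. scal E (h q v (Y p i q)) (X p i q)) = v" if "q \<in> V p" "v \<in> fibre E q" for p q v
    using dual[of p] that by simp
  obtain I :: "'a set" and b :: "'a \<Rightarrow> 'a \<Rightarrow> real" and C where I: "finite I"
    and b: "\<And>a. smooth_fun M UNIV (b a)" and C: "\<And>a. closed (C a)" "\<And>a. C a \<subseteq> V a"
    "\<And>a q. q \<notin> C a \<Longrightarrow> b a q = 0" and pos: "\<And>q. 0 < (\<Sum>a\<in>I. (b a q)\<^sup>2)"
    using bump_cover[OF assms, of V] loc(1,2) by metis
  define S where "S = (\<lambda>q. \<Sum>a\<in>I. (b a q)\<^sup>2)"
  have S: "smooth_fun M UNIV (\<lambda>q. inverse (S q))"
    using pos unfolding S_def power2_eq_square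
    by (intro smooth_fun_inverse smooth_fun_sum smooth_fun_mult b) (simp add: less_imp_neq[symmetric])
  \<comment> \<open>Nothing is known about a local section outside \<open>V a\<close>, hence the
    explicit \<open>0\<close>; the extension is smooth when \<open>f\<close> vanishes off the closed
    set \<open>C a\<close>.\<close>
  define cut where "cut = (\<lambda>f :: 'a \<Rightarrow> real. \<lambda>a (\<sigma> :: 'a \<Rightarrow> 'v) q.
    if q \<in> V a then scal E (of_real (f q)) (\<sigma> q) else 0)"
  have cut: "cut f a \<sigma> \<in> sections M E"
    if "smooth_fun M UNIV f" "\<And>q. q \<notin> C a \<Longrightarrow> f q = 0" "smooth_section (V a) \<sigma>" for f a \<sigma>
  proof -
    have "smooth_section (V a) (\<lambda>q. scal E (of_real (f q)) (\<sigma> q))"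
      using that(1,3) by (intro smooth_section_scale smooth_fun_linear[OF bounded_linear_of_real])
        (auto intro: smooth_fun_subset)
    then have "smooth_section (V a) (cut f a \<sigma>)"
      by (rule smooth_section_cong) (simp add: cut_def)
    then have "smooth_section UNIV (cut f a \<sigma>)"
      using loc(1) C(1,2) that(2) by (intro smooth_section_zero_extension[of "V a" "C a"]) (auto simp: cut_def)
    then show ?thesis by (simp add: sections_def)
  qed
  define X' where "X' = (\<lambda>(a, i). cut (\<lambda>q. inverse (S q) * b a q) a (X a i))"
  define Y' where "Y' = (\<lambda>(a, i). cut (b a) a (Y a i))"
  \<comment> \<open>A generator is indexed by a patch together with an index of its local dual
    pair.\<close>
  define K where "K = Sigma I (\<lambda>a. {..<r a})"
  have X': "X' k \<in> sections M E" and Y': "Y' k \<in> sections M E" if "k \<in> K" for k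
    using that S b C(3) loc(3,4) unfolding K_def X'_def Y'_def
    by (auto intro!: cut smooth_fun_mult)
  have sum: "(\<Sum>k\<in>K. scal E (h q v (Y' k q)) (X' k q)) = v" if v: "v \<in> fibre E q" for q v
  proof -
    have "(\<Sum>i<r a. scal E (h q v (Y' (a, i) q)) (X' (a, i) q)) = scal E (of_real (inverse (S q) * (b a q)\<^sup>2)) v" for a
    proof (cases "q \<in> V a")
      case True
      have "h q v (Y' (a, i) q) = of_real (b a q) * h q v (Y a i q)" if "i < r a" for i
        using True section_fibre[OF loc(4)[OF that]] v
        by (simp add: Y'_def cut_def scale_right conj_of_real)
      then have "(\<Sum>i<r a. scal E (h q v (Y' (a, i) q)) (X' (a, i) q)) =
          (\<Sum>i<r a. scal E (of_real (inverse (S q) * (b a q)\<^sup>2)) (scal E (h q v (Y a i q)) (X a i q)))"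
        using True by (intro sum.cong) (auto simp: X'_def cut_def power2_eq_square mult_ac)
      also have "\<dots> = scal E (of_real (inverse (S q) * (b a q)\<^sup>2)) v"
        by (simp only: vs.scale_sum_right[symmetric] expand[OF True v])
      finally show ?thesis .
    next
      case False
      then have "b a q = 0" using C(2,3) by blast
      with False show ?thesis by (simp add: X'_def cut_def)
    qed
    moreover have "(\<Sum>k\<in>K. scal E (h q v (Y' k q)) (X' k q)) =
        (\<Sum>a\<in>I. \<Sum>i<r a. scal E (h q v (Y' (a, i) q)) (X' (a, i) q))"
      using sum.Sigma[of I "\<lambda>a. {..<r a}" "\<lambda>a i. scal E (h q v (Y' (a, i) q)) (X' (a, i) q)"] I
      by (simp add: K_def case_prod_beta')
    ultimately have "(\<Sum>k\<in>K. scal E (h q v (Y' k q)) (X' k q)) =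
        (\<Sum>a\<in>I. scal E (of_real (inverse (S q) * (b a q)\<^sup>2)) v)"
      by (simp only:)
    also have "\<dots> = scal E (of_real (inverse (S q) * S q)) v"
      unfolding S_def by (simp only: vs.scale_sum_left sum_distrib_left of_real_sum)
    also have "\<dots> = v" using pos[of q] by (simp add: S_def)
    finally show ?thesis .
  qed
  have "finite K" using I by (simp add: K_def)
  \<comment> \<open>The finitely many pairs are renumbered by an initial segment of the natural
    numbers.\<close>
  then obtain \<kappa> where \<kappa>: "bij_betw \<kappa> {..<card K} K"
    using ex_bij_betw_nat_finite[of K] by (auto simp: atLeast0LessThan)
  show ?thesis
  proof (rule that[of "card K" "\<lambda>k. X' (\<kappa> k)" "\<lambda>k. Y' (\<kappa> k)"])
    show "\<forall>p. \<forall>v\<in>fibre E p. v = (\<Sum>k<card K. scal E (h p v (Y' (\<kappa> k) p)) (X' (\<kappa> k) p))"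
    proof (intro allI ballI)
      fix p v assume "v \<in> fibre E p"
      then show "v = (\<Sum>k<card K. scal E (h p v (Y' (\<kappa> k) p)) (X' (\<kappa> k) p))"
        using sum sum.reindex_bij_betw[OF \<kappa>, of "\<lambda>k. scal E (h p v (Y' k p)) (X' k p)"] by simp
    qed
  qed (use X' Y' bij_betwE[OF \<kappa>] in auto)
qed

end

section \<open>The Dirac operator in terms of generating sections\<close>

lemma (in corner_manifold) metric_bundle_real:
  assumes "vector_bundle M A" "bundle_metric M A g"
  shows "metric_bundle M A (\<lambda>x. x) g"
proof -
  note metric = assms(2)[unfolded bundle_metric_def]
  have *: "g p a b = g p b a \<and> (\<forall>c\<in>fibre A p. g p (a + b) c = g p a c + g p b c) \<and>
      (\<forall>t. g p (scal A t a) b = t * g p a b)"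
    if "a \<in> fibre A p" "b \<in> fibre A p" for p a b
    using spec[OF conjunct1[OF metric], THEN bspec, THEN bspec, OF that] .
  have g: "\<And>p a b. a \<in> fibre A p \<Longrightarrow> b \<in> fibre A p \<Longrightarrow> g p a b = g p b a"
    "\<And>p a b c. a \<in> fibre A p \<Longrightarrow> b \<in> fibre A p \<Longrightarrow> c \<in> fibre A p \<Longrightarrow> g p (a + b) c = g p a c + g p b c"
    "\<And>p a b t. a \<in> fibre A p \<Longrightarrow> b \<in> fibre A p \<Longrightarrow> g p (scal A t a) b = t * g p a b"
    "\<And>p a. a \<in> fibre A p \<Longrightarrow> a \<noteq> 0 \<Longrightarrow> 0 < g p a a"
    "\<And>U r s i j. (U, r, s) \<in> frames A \<Longrightarrow> i < r \<Longrightarrow> j < r \<Longrightarrow> smooth_fun M U (\<lambda>p. g p (s i p) (s j p))"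
    using * conjunct2[OF metric] by auto
  interpret smooth_bundle M A by unfold_locales (rule assms(1))
  show ?thesis
  proof unfold_locales
    fix p v w u assume *: "v \<in> fibre A p" "w \<in> fibre A p" "u \<in> fibre A p"
    show "g p u (v + w) = g p u v + g p u w"
      using g(1)[OF *(3) fibre_add[OF *(1,2)]] g(1)[OF *(3,1)] g(1)[OF *(3,2)] g(2)[OF *] by simp
  next
    fix p v u t assume *: "v \<in> fibre A p" "u \<in> fibre A p"
    show "g p u (scal A t v) = t * g p u v"
      using g(1)[OF *(2) fibre_scale[OF *(1)]] g(1)[OF *(2,1)] g(3)[OF *] by simp
  next
    fix p v u assume "v \<in> fibre A p" "u \<in> fibre A p" "g p u v = 0"
    then show "g p v u = 0" using g(1) by simp
  next
    fix p v assume "v \<in> fibre A p" "v \<noteq> 0"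
    then show "g p v v \<noteq> 0" using g(4)[of v p] by simp
  \<comment> \<open>The constant \<open>1\<close> is the norm bound of the identity map, demanded by
    bounded linearity of \<open>conj\<close>.\<close>
  qed (auto intro: exI[of _ 1] g(2,3,5))
qed

lemma (in corner_manifold) metric_bundle_complex:
  assumes "vector_bundle M W" "Hermitian_metric M W h"
  shows "metric_bundle M W cnj h"
proof -
  note metric = assms(2)[unfolded Hermitian_metric_def]
  have *: "h p a b = cnj (h p b a) \<and> (\<forall>c\<in>fibre W p. h p (a + b) c = h p a c + h p b c) \<and>
      (\<forall>z. h p (scal W z a) b = z * h p a b)"
    if "a \<in> fibre W p" "b \<in> fibre W p" for p a b
    using spec[OF conjunct1[OF metric], THEN bspec, THEN bspec, OF that] .
  note h = conjunct1[OF *] bspec[OF conjunct1[OF conjunct2[OF *]]] spec[OF conjunct2[OF conjunct2[OF *]]]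
  have h': "\<And>p a. a \<in> fibre W p \<Longrightarrow> a \<noteq> 0 \<Longrightarrow> 0 < Re (h p a a)"
    "\<And>U r s i j. (U, r, s) \<in> frames W \<Longrightarrow> i < r \<Longrightarrow> j < r \<Longrightarrow> smooth_fun M U (\<lambda>p. h p (s i p) (s j p))"
    using conjunct2[OF metric] by auto
  interpret smooth_bundle M W by unfold_locales (rule assms(1))
  show ?thesis
  proof unfold_locales
    fix p v w u assume *: "v \<in> fibre W p" "w \<in> fibre W p" "u \<in> fibre W p"
    show "h p u (v + w) = h p u v + h p u w"
      using h(1)[OF *(3) fibre_add[OF *(1,2)]] h(1)[OF *(3,1)] h(1)[OF *(3,2)] h(2)[OF *] by simp
  next
    fix p v u z assume *: "v \<in> fibre W p" "u \<in> fibre W p"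
    show "h p u (scal W z v) = cnj z * h p u v"
      using h(1)[OF *(2) fibre_scale[OF *(1)]] h(1)[OF *(2,1)] h(3)[OF *] by simp
  next
    fix p v u assume *: "v \<in> fibre W p" "u \<in> fibre W p" "h p u v = 0"
    then show "h p v u = 0" using h(1)[OF *(1,2)] by simp
  next
    fix p v assume "v \<in> fibre W p" "v \<noteq> 0"
    then show "h p v v \<noteq> 0" using h'(1)[of v p] by auto
  qed (auto intro: exI[of _ 1] h(2,3) h'(2))
qed

text \<open>\<open>D\<close> is the connection on \<open>W\<close>. Symmetry of \<open>g\<close> is
  listed separately because \<open>metric_bundle\<close> provides only symmetry of orthogonality,
  whereas computing \<open>sharp\<close> swaps the arguments of \<open>g\<close>.\<close>

locale Clifford_bundle = A: metric_bundle M A "\<lambda>x. x" g + W: metric_bundle M W cnj h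
  for M :: "('a::{t2_space,second_countable_topology}, 'n::finite) manifold"
    and A :: "('a, real, 'e::ab_group_add) vbundle" and g
    and W :: "('a, complex, 'w::ab_group_add) vbundle" and h +
  fixes \<rho> :: "'a \<Rightarrow> 'e \<Rightarrow> ('a \<Rightarrow> real) \<Rightarrow> real"
    and D :: "('a \<Rightarrow> 'w) \<Rightarrow> 'a \<Rightarrow> 'e \<Rightarrow> 'w"
    and cl :: "'a \<Rightarrow> 'e \<Rightarrow> 'w \<Rightarrow> 'w"
  assumes compact: "compact (UNIV :: 'a set)"
    and g_sym: "a \<in> fibre A p \<Longrightarrow> b \<in> fibre A p \<Longrightarrow> g p a b = g p b a"
    and connection: "A_connection M A \<rho> W D" and Clifford: "Clifford_map M A W cl"
begin

section \<open>Clifford multiplication of sections\<close>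

lemma cl_fibre: "a \<in> fibre A p \<Longrightarrow> w \<in> fibre W p \<Longrightarrow> cl p a w \<in> fibre W p"
  and cl_add_left: "a \<in> fibre A p \<Longrightarrow> b \<in> fibre A p \<Longrightarrow> w \<in> fibre W p \<Longrightarrow> cl p (a + b) w = cl p a w + cl p b w"
  and cl_add_right: "a \<in> fibre A p \<Longrightarrow> v \<in> fibre W p \<Longrightarrow> w \<in> fibre W p \<Longrightarrow> cl p a (v + w) = cl p a v + cl p a w"
  and cl_scale_left: "a \<in> fibre A p \<Longrightarrow> w \<in> fibre W p \<Longrightarrow> cl p (scal A t a) w = scal W (of_real t) (cl p a w)"
  and cl_scale_right: "a \<in> fibre A p \<Longrightarrow> w \<in> fibre W p \<Longrightarrow> cl p a (scal W z w) = scal W z (cl p a w)"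
  and cl_smooth: "(U, r, s) \<in> frames A \<Longrightarrow> (U', r', s') \<in> frames W \<Longrightarrow> i < r \<Longrightarrow> j < r' \<Longrightarrow>
    W.smooth_section (U \<inter> U') (\<lambda>p. cl p (s i p) (s' j p))"
  using Clifford unfolding Clifford_map_def by blast+

lemma cl_lincomb_left:
  assumes w: "w \<in> fibre W p" and "\<And>i. i \<in> I \<Longrightarrow> a i \<in> fibre A p"
  shows "cl p (\<Sum>i\<in>I. scal A (t i) (a i)) w = (\<Sum>i\<in>I. scal W (of_real (t i)) (cl p (a i) w))"
  using assms(2)
proof (induction I rule: infinite_finite_induct)
  case (insert i I)
  then show ?case
    by (simp add: cl_add_left cl_scale_left w A.fibre_scale A.fibre_sum)
qed (use cl_add_left[OF A.fibre_zero A.fibre_zero w] in auto)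

lemma cl_lincomb_right:
  assumes a: "a \<in> fibre A p" and "\<And>i. i \<in> I \<Longrightarrow> w i \<in> fibre W p"
  shows "cl p a (\<Sum>i\<in>I. scal W (z i) (w i)) = (\<Sum>i\<in>I. scal W (z i) (cl p a (w i)))"
  using assms(2)
proof (induction I rule: infinite_finite_induct)
  case (insert i I)
  then show ?case
    by (simp add: cl_add_right cl_scale_right a W.fibre_scale W.fibre_sum)
qed (use cl_add_right[OF a W.fibre_zero W.fibre_zero] in auto)

text \<open>\<open>Clifford_map\<close> controls smoothness only for products of frame sections;
  expanding both factors over a common domain \<open>U \<inter> U'\<close> reduces to these, and
  smoothness of sections is local.\<close>

lemma cl_section:
  assumes X: "X \<in> sections M A" and w: "\<xi> \<in> sections M W"
  shows "(\<lambda>p. cl p (X p) (\<xi> p)) \<in> sections M W"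
  unfolding sections_def
proof (intro CollectI W.smooth_section_local)
  fix p
  obtain U r s where f: "(U, r, s) \<in> frames A" and pU: "p \<in> U" by (rule A.frame_at)
  obtain U' r' s' where f': "(U', r', s') \<in> frames W" and pU': "p \<in> U'" by (rule W.frame_at)
  obtain c where c: "\<forall>i<r. smooth_fun M (UNIV \<inter> U) (c i)"
    "\<forall>p\<in>UNIV \<inter> U. X p = (\<Sum>i<r. scal A (c i p) (s i p))"
    using X f unfolding sections_def mem_Collect_eq by (rule A.section_coords)
  obtain d where d: "\<forall>i<r'. smooth_fun M (UNIV \<inter> U') (d i)"
    "\<forall>p\<in>UNIV \<inter> U'. \<xi> p = (\<Sum>i<r'. scal W (d i p) (s' i p))"
    using w f' unfolding sections_def mem_Collect_eq by (rule W.section_coords)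
  have cs: "smooth_fun M (U \<inter> U') (c i)" if "i < r" for i
    using c(1) that by (auto intro: A.smooth_fun_subset[of U])
  have ds: "smooth_fun M (U \<inter> U') (d i)" if "i < r'" for i
    using d(1) that by (auto intro: A.smooth_fun_subset[of U'])
  have "W.smooth_section (U \<inter> U') (\<lambda>p. \<Sum>i<r. scal W (of_real (c i p))
      (\<Sum>j<r'. scal W (d j p) (cl p (s i p) (s' j p))))"
    by (intro W.smooth_section_sum W.smooth_section_scale A.smooth_fun_linear[OF bounded_linear_of_real]
        cl_smooth[OF f f']) (auto intro: cs ds)
  then have "W.smooth_section (U \<inter> U') (\<lambda>p. cl p (X p) (\<xi> p))"
  proof (rule W.smooth_section_cong)
    fix q assume q: "q \<in> U \<inter> U'"
    have sA: "s i q \<in> fibre A q" if "i < r" for i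
      using A.section_fibre[OF A.frame(2)[OF f that]] q by blast
    have sW: "s' i q \<in> fibre W q" if "i < r'" for i
      using W.section_fibre[OF W.frame(2)[OF f' that]] q by blast
    have \<xi>F: "\<xi> q \<in> fibre W q"
      using w W.section_fibre unfolding sections_def by auto
    have Xq: "X q = (\<Sum>i<r. scal A (c i q) (s i q))" and \<xi>q: "\<xi> q = (\<Sum>i<r'. scal W (d i q) (s' i q))"
      using c(2) d(2) q by auto
    have "cl q (X q) (\<xi> q) = (\<Sum>i<r. scal W (of_real (c i q)) (cl q (s i q) (\<xi> q)))"
      unfolding Xq by (rule cl_lincomb_left) (use \<xi>F sA in auto)
    also have "\<dots> = (\<Sum>i<r. scal W (of_real (c i q)) (\<Sum>j<r'. scal W (d j q) (cl q (s i q) (s' j q))))"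
      unfolding \<xi>q by (intro sum.cong refl arg_cong[where f = "scal W _"] cl_lincomb_right) (use sA sW in auto)
    finally show "(\<Sum>i<r. scal W (of_real (c i q)) (\<Sum>j<r'. scal W (d j q) (cl q (s i q) (s' j q)))) =
        cl q (X q) (\<xi> q)" ..
  qed
  moreover have "open (U \<inter> U')" using A.frame(1)[OF f] W.frame(1)[OF f'] by auto
  ultimately show "\<exists>G. open G \<and> p \<in> G \<and> W.smooth_section (UNIV \<inter> G) (\<lambda>p. cl p (X p) (\<xi> p))"
    using pU pU' by (intro exI[of _ "U \<inter> U'"]) simp
qed

lemma section_in_fibre:
  "X \<in> sections M A \<Longrightarrow> X p \<in> fibre A p" "\<xi> \<in> sections M W \<Longrightarrow> \<xi> p \<in> fibre W p"
  using A.section_fibre[of UNIV X p] W.section_fibre[of UNIV \<xi> p] by (auto simp: sections_def)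

lemma scale_section:
  "smooth_fun M UNIV u \<Longrightarrow> \<xi> \<in> sections M W \<Longrightarrow> (\<lambda>p. scal W (u p) (\<xi> p)) \<in> sections M W"
  by (simp add: sections_def W.smooth_section_scale)

lemma sum_section:
  "(\<And>i. i \<in> I \<Longrightarrow> \<xi> i \<in> sections M W) \<Longrightarrow> (\<lambda>p. \<Sum>i\<in>I. \<xi> i p) \<in> sections M W"
  by (simp add: sections_def W.smooth_section_sum)

lemma metric_smooth:
  "\<xi> \<in> sections M W \<Longrightarrow> \<eta> \<in> sections M W \<Longrightarrow> smooth_fun M UNIV (\<lambda>p. h p (\<xi> p) (\<eta> p))"
  by (simp add: sections_def W.smooth_metric)

section \<open>Calculus of the connection\<close>

lemma D_tensor: "\<xi> \<in> sections M W \<Longrightarrow> D \<xi> \<in> tensor_dual_sections M A W"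
  and D_add: "\<xi> \<in> sections M W \<Longrightarrow> \<eta> \<in> sections M W \<Longrightarrow>
    D (\<lambda>p. \<xi> p + \<eta> p) = (\<lambda>p a. D \<xi> p a + D \<eta> p a)"
  and D_scale: "\<xi> \<in> sections M W \<Longrightarrow> D (\<lambda>p. scal W z (\<xi> p)) = (\<lambda>p a. scal W z (D \<xi> p a))"
  and D_Leibniz_real: "X \<in> sections M A \<Longrightarrow> f \<in> Cinf M UNIV \<Longrightarrow> \<xi> \<in> sections M W \<Longrightarrow>
    D (\<lambda>q. scal W (of_real (f q)) (\<xi> q)) p (X p) =
      scal W (of_real (f p)) (D \<xi> p (X p)) + scal W (of_real (anchor_field M \<rho> X f p)) (\<xi> p)"
  using connection unfolding A_connection_def by blast+

lemma D_fibre: "\<xi> \<in> sections M W \<Longrightarrow> a \<in> fibre A p \<Longrightarrow> D \<xi> p a \<in> fibre W p"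
  and D_add_direction: "\<xi> \<in> sections M W \<Longrightarrow> a \<in> fibre A p \<Longrightarrow> b \<in> fibre A p \<Longrightarrow>
    D \<xi> p (a + b) = D \<xi> p a + D \<xi> p b"
  and D_scale_direction: "\<xi> \<in> sections M W \<Longrightarrow> a \<in> fibre A p \<Longrightarrow>
    D \<xi> p (scal A t a) = scal W (of_real t) (D \<xi> p a)"
  and D_smooth: "\<xi> \<in> sections M W \<Longrightarrow> (U, r, s) \<in> frames A \<Longrightarrow> i < r \<Longrightarrow>
    W.smooth_section U (\<lambda>p. D \<xi> p (s i p))"
  using D_tensor unfolding tensor_dual_sections_def by blast+

lemma D_lincomb_direction:
  assumes \<xi>: "\<xi> \<in> sections M W" and "\<And>i. i \<in> I \<Longrightarrow> a i \<in> fibre A p"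
  shows "D \<xi> p (\<Sum>i\<in>I. scal A (t i) (a i)) = (\<Sum>i\<in>I. scal W (of_real (t i)) (D \<xi> p (a i)))"
  using assms(2)
proof (induction I rule: infinite_finite_induct)
  case (insert i I)
  then show ?case
    by (simp add: D_add_direction D_scale_direction \<xi> A.fibre_scale A.fibre_sum)
qed (use D_add_direction[OF \<xi> A.fibre_zero A.fibre_zero] in auto)

text \<open>Smoothness along frame sections of \<open>A\<close> is part of
  \<open>tensor_dual_sections\<close>; fibrewise linearity in the direction extends it to an
  arbitrary section \<open>X\<close>.\<close>

lemma D_section:
  assumes \<xi>: "\<xi> \<in> sections M W" and X: "X \<in> sections M A"
  shows "(\<lambda>p. D \<xi> p (X p)) \<in> sections M W"
  unfolding sections_def
proof (intro CollectI W.smooth_section_local)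
  fix p
  obtain U r s where f: "(U, r, s) \<in> frames A" and pU: "p \<in> U" by (rule A.frame_at)
  obtain c where c: "\<forall>i<r. smooth_fun M (UNIV \<inter> U) (c i)"
    "\<forall>p\<in>UNIV \<inter> U. X p = (\<Sum>i<r. scal A (c i p) (s i p))"
    using X f unfolding sections_def mem_Collect_eq by (rule A.section_coords)
  have "W.smooth_section U (\<lambda>p. \<Sum>i<r. scal W (of_real (c i p)) (D \<xi> p (s i p)))"
    using c(1) by (intro W.smooth_section_sum W.smooth_section_scale
        A.smooth_fun_linear[OF bounded_linear_of_real] D_smooth[OF \<xi> f]) auto
  then have "W.smooth_section U (\<lambda>p. D \<xi> p (X p))"
  proof (rule W.smooth_section_cong)
    fix q assume q: "q \<in> U"
    have sA: "s i q \<in> fibre A q" if "i < r" for i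
      using A.section_fibre[OF A.frame(2)[OF f that]] q by blast
    have Xq: "X q = (\<Sum>i<r. scal A (c i q) (s i q))"
      using c(2) q by auto
    show "(\<Sum>i<r. scal W (of_real (c i q)) (D \<xi> q (s i q))) = D \<xi> q (X q)"
      unfolding Xq by (rule D_lincomb_direction[symmetric, OF \<xi>]) (use sA in auto)
  qed
  then show "\<exists>G. open G \<and> p \<in> G \<and> W.smooth_section (UNIV \<inter> G) (\<lambda>p. D \<xi> p (X p))"
    using pU A.frame(1)[OF f] by auto
qed

lemma D_sum:
  assumes "\<And>l. l \<in> I \<Longrightarrow> \<xi> l \<in> sections M W"
  shows "D (\<lambda>p. \<Sum>l\<in>I. \<xi> l p) p a = (\<Sum>l\<in>I. D (\<xi> l) p a)"
  using assms
proof (induction I rule: infinite_finite_induct)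
  case (insert i I)
  then show ?case by (simp add: D_add sum_section)
\<comment> \<open>For the empty sum, scaling by \<open>0\<close> shows that \<open>D\<close>
  annihilates the zero section.\<close>
qed (use D_scale[of "\<lambda>_. 0" 0] W.smooth_section_zero in \<open>simp_all add: sections_def fun_eq_iff\<close>)

lemma scale_Re_Im: "scal W z w = scal W (of_real (Re z)) w + scal W (of_real (Im z)) (scal W \<i> w)"
proof -
  have "scal W z w = scal W (of_real (Re z) + of_real (Im z) * \<i>) w"
    by (metis complex_eq mult.commute)
  then show ?thesis by (simp add: W.vs.scale_left_distrib)
qed

text \<open>The connection axiom covers real functions only. One splits the product into
  \<open>Re u\<close> times \<open>\<xi>\<close> plus \<open>Im u\<close> times
  \<open>\<i> \<xi>\<close>; since \<open>D\<close> commutes with the constant \<open>\<i>\<close>,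
  the two real rules recombine into \<open>complex_action\<close>, which acts on real and imaginary
  parts separately.\<close>

lemma D_Leibniz:
  assumes X: "X \<in> sections M A" and u: "smooth_fun M UNIV u" and \<xi>: "\<xi> \<in> sections M W"
  shows "D (\<lambda>q. scal W (u q) (\<xi> q)) p (X p) =
    scal W (u p) (D \<xi> p (X p)) + scal W (complex_action (anchor_field M \<rho> X) u p) (\<xi> p)"
proof -
  let ?X = "anchor_field M \<rho> X"
  define \<eta> where "\<eta> = (\<lambda>q. scal W \<i> (\<xi> q))"
  have Re: "smooth_fun M UNIV (\<lambda>q. Re (u q))" and Im: "smooth_fun M UNIV (\<lambda>q. Im (u q))"
    using A.smooth_fun_linear[OF _ u] bounded_linear_Re bounded_linear_Im by blast+
  have \<eta>: "\<eta> \<in> sections M W"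
    unfolding \<eta>_def using \<xi> by (intro scale_section A.smooth_fun_const)
  have of_real: "smooth_fun M UNIV (\<lambda>q. complex_of_real (f q))" if "smooth_fun M UNIV f" for f
    using A.smooth_fun_linear[OF bounded_linear_of_real that] .
  have "(\<lambda>q. scal W (u q) (\<xi> q)) =
      (\<lambda>q. scal W (of_real (Re (u q))) (\<xi> q) + scal W (of_real (Im (u q))) (\<eta> q))"
    unfolding \<eta>_def by (rule ext) (rule scale_Re_Im)
  then have "D (\<lambda>q. scal W (u q) (\<xi> q)) p (X p) =
      D (\<lambda>q. scal W (of_real (Re (u q))) (\<xi> q)) p (X p) + D (\<lambda>q. scal W (of_real (Im (u q))) (\<eta> q)) p (X p)"
    by (simp add: D_add scale_section of_real Re Im \<xi> \<eta>)
  also have "D (\<lambda>q. scal W (of_real (Re (u q))) (\<xi> q)) p (X p) =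
      scal W (of_real (Re (u p))) (D \<xi> p (X p)) + scal W (of_real (?X (\<lambda>q. Re (u q)) p)) (\<xi> p)"
    by (rule D_Leibniz_real[OF X _ \<xi>]) (simp add: Cinf_def Re)
  also have "D (\<lambda>q. scal W (of_real (Im (u q))) (\<eta> q)) p (X p) =
      scal W (of_real (Im (u p))) (D \<eta> p (X p)) + scal W (of_real (?X (\<lambda>q. Im (u q)) p)) (\<eta> p)"
    by (rule D_Leibniz_real[OF X _ \<eta>]) (simp add: Cinf_def Im)
  also have "D \<eta> p (X p) = scal W \<i> (D \<xi> p (X p))"
    unfolding \<eta>_def D_scale[OF \<xi>] ..
  finally show ?thesis
    unfolding scale_Re_Im[of "u p"] scale_Re_Im[of "complex_action (anchor_field M \<rho> X) u p"]
    by (simp add: \<eta>_def complex_action_def)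
qed

section \<open>The isomorphism sharp and the Clifford contraction\<close>

lemma sharp_eqI:
  assumes a: "a \<in> fibre A p" and eq: "\<And>b. b \<in> fibre A p \<Longrightarrow> g p a b = \<beta> b"
  shows "sharp A g p \<beta> = a"
  unfolding sharp_def
proof (rule the_equality)
  fix c assume c: "c \<in> fibre A p \<and> (\<forall>b\<in>fibre A p. g p c b = \<beta> b)"
  \<comment> \<open>Two candidates differ by a vector orthogonal to the whole fibre, in particular
    to itself, so definiteness makes it vanish.\<close>
  have d: "c - a \<in> fibre A p" using a c by (simp add: A.fibre_diff)
  have "g p ((c - a) + a) (c - a) = g p (c - a) (c - a) + g p a (c - a)"
    using A.add_left d a by blast
  then have "g p (c - a) (c - a) = 0" using eq[OF d] c d by simp
  then show "c = a" using A.definite[OF d] by auto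
qed (use assms in auto)

text \<open>One representation of the tensor is the sum over \<open>j\<close> of
  \<open>D \<phi> p (Y j)\<close> tensor \<open>X j\<close>. The definite description also demands
  that every other representation contract to the same vector: evaluating it on the functionals
  \<open>g p b (Y j)\<close> of \<open>b\<close> recovers \<open>D \<phi> p (Y j)\<close>, and the
  dual expansion resums the result.\<close>

lemma Clifford_contraction_sharp:
  fixes N :: nat
  assumes \<phi>: "\<phi> \<in> sections M W"
    and X: "\<And>j. j < N \<Longrightarrow> X j \<in> fibre A p" and Y: "\<And>j. j < N \<Longrightarrow> Y j \<in> fibre A p"
    and dual: "\<And>a. a \<in> fibre A p \<Longrightarrow> a = (\<Sum>j<N. scal A (g p a (Y j)) (X j))"
  shows "Clifford_contraction A W cl p (id_tensor_sharp A g p (D \<phi> p)) = (\<Sum>j<N. cl p (X j) (D \<phi> p (Y j)))"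
  unfolding Clifford_contraction_def id_tensor_sharp_def
proof (rule the_equality)
  have "D \<phi> p (sharp A g p \<beta>) = (\<Sum>j<N. scal W (of_real (\<beta> (X j))) (D \<phi> p (Y j)))"
    if \<beta>: "\<beta> \<in> dual_fibre A p" for \<beta>
  proof -
    have \<beta>: "\<beta> (a + b) = \<beta> a + \<beta> b" "\<beta> (scal A t a) = t * \<beta> a"
      if "a \<in> fibre A p" "b \<in> fibre A p" for a b t
      using \<beta> that unfolding dual_fibre_def by simp_all
    \<comment> \<open>The induction runs over subsets of \<open>{..<N}\<close> because
      \<open>X j\<close> is known to lie in the fibre only for \<open>j < N\<close>.\<close>
    have \<beta>_lin: "\<beta> (\<Sum>j\<in>J. scal A (t j) (X j)) = (\<Sum>j\<in>J. t j * \<beta> (X j))" if "J \<subseteq> {..<N}" for t J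
      using finite_subset[OF that finite_lessThan] that
    proof (induction J rule: finite_induct)
      case empty
      show ?case using \<beta>(2)[OF A.fibre_zero A.fibre_zero, of 0] by simp
    next
      case (insert j J)
      then have "X j \<in> fibre A p" "(\<Sum>j\<in>J. scal A (t j) (X j)) \<in> fibre A p"
        using X by (auto intro!: A.fibre_sum A.fibre_scale)
      then have "\<beta> (scal A (t j) (X j) + (\<Sum>j\<in>J. scal A (t j) (X j))) =
          t j * \<beta> (X j) + \<beta> (\<Sum>j\<in>J. scal A (t j) (X j))"
        by (simp add: \<beta> A.fibre_scale)
      then show ?case using insert by simp
    qed
    \<comment> \<open>Pairing the right-hand side with \<open>b\<close> gives \<open>\<beta>\<close>
      applied to the dual expansion of \<open>b\<close>, which is \<open>\<beta> b\<close>.\<close>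
    have "sharp A g p \<beta> = (\<Sum>j<N. scal A (\<beta> (X j)) (Y j))"
    proof (rule sharp_eqI)
      fix b assume b: "b \<in> fibre A p"
      have "g p (\<Sum>j<N. scal A (\<beta> (X j)) (Y j)) b = (\<Sum>j<N. \<beta> (X j) * g p (Y j) b)"
        using b Y by (intro A.lincomb_left) auto
      also have "\<dots> = (\<Sum>j<N. g p b (Y j) * \<beta> (X j))"
        using g_sym b Y by (intro sum.cong) auto
      also have "\<dots> = \<beta> (\<Sum>j<N. scal A (g p b (Y j)) (X j))"
        by (rule \<beta>_lin[symmetric]) simp
      also have "\<dots> = \<beta> b"
        using dual[OF b] by simp
      finally show "g p (\<Sum>j<N. scal A (\<beta> (X j)) (Y j)) b = \<beta> b" .
    qed (auto intro!: A.fibre_sum A.fibre_scale Y)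
    then show ?thesis
      using D_lincomb_direction[OF \<phi>, of "{..<N}" Y p "\<lambda>j. \<beta> (X j)"] Y by simp
  qed
  then show "\<exists>m w a. (\<forall>k<m::nat. w k \<in> fibre W p \<and> a k \<in> fibre A p) \<and>
      (\<forall>\<beta>\<in>dual_fibre A p. D \<phi> p (sharp A g p \<beta>) = (\<Sum>k<m. scal W (of_real (\<beta> (a k))) (w k))) \<and>
      (\<Sum>j<N. cl p (X j) (D \<phi> p (Y j))) = (\<Sum>k<m. cl p (a k) (w k))"
    using X Y D_fibre[OF \<phi>] by (intro exI[of _ N] exI[of _ "\<lambda>j. D \<phi> p (Y j)"] exI[of _ X]) simp
next
  fix x
  assume "\<exists>m w a. (\<forall>k<m::nat. w k \<in> fibre W p \<and> a k \<in> fibre A p) \<and>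
      (\<forall>\<beta>\<in>dual_fibre A p. D \<phi> p (sharp A g p \<beta>) = (\<Sum>k<m. scal W (of_real (\<beta> (a k))) (w k))) \<and>
      x = (\<Sum>k<m. cl p (a k) (w k))"
  then obtain m :: nat and w a where wa: "\<forall>k<m. w k \<in> fibre W p \<and> a k \<in> fibre A p"
    and rep: "\<forall>\<beta>\<in>dual_fibre A p. D \<phi> p (sharp A g p \<beta>) = (\<Sum>k<m. scal W (of_real (\<beta> (a k))) (w k))"
    and x: "x = (\<Sum>k<m. cl p (a k) (w k))"
    by (elim exE conjE)
  have w: "w k \<in> fibre W p" and a: "a k \<in> fibre A p" if "k < m" for k
    using wa that by auto
  have DY: "D \<phi> p (Y j) = (\<Sum>k<m. scal W (of_real (g p (a k) (Y j))) (w k))" if j: "j < N" for j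
  proof -
    \<comment> \<open>The functional represented by \<open>Y j\<close>, extended by \<open>0\<close>
      off the fibre as \<open>dual_fibre\<close> prescribes.\<close>
    define \<alpha> where "\<alpha> = (\<lambda>b. if b \<in> fibre A p then g p b (Y j) else 0)"
    have "\<alpha> \<in> dual_fibre A p"
      unfolding dual_fibre_def \<alpha>_def using Y[OF j] A.vs.subspace_scale[OF A.fibre_subspace]
      by (auto simp: A.fibre_add A.add_left A.scale_left A.fibre_scale)
    moreover have "sharp A g p \<alpha> = Y j"
      by (rule sharp_eqI) (use Y[OF j] g_sym in \<open>auto simp: \<alpha>_def\<close>)
    ultimately show ?thesis
      using bspec[OF rep, of \<alpha>] a by (simp add: \<alpha>_def)
  qed
  have "(\<Sum>j<N. cl p (X j) (D \<phi> p (Y j))) =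
      (\<Sum>j<N. \<Sum>k<m. scal W (of_real (g p (a k) (Y j))) (cl p (X j) (w k)))"
  proof (intro sum.cong refl)
    fix j assume "j \<in> {..<N}"
    then have j: "j < N" by simp
    show "cl p (X j) (D \<phi> p (Y j)) = (\<Sum>k<m. scal W (of_real (g p (a k) (Y j))) (cl p (X j) (w k)))"
      unfolding DY[OF j] by (rule cl_lincomb_right) (use X[OF j] w in auto)
  qed
  also have "\<dots> = (\<Sum>k<m. \<Sum>j<N. scal W (of_real (g p (a k) (Y j))) (cl p (X j) (w k)))"
    by (rule sum.swap)
  \<comment> \<open>After the exchange of sums, the inner sum over \<open>j\<close> is the dual
    expansion of \<open>a k\<close>.\<close>
  also have "\<dots> = (\<Sum>k<m. cl p (\<Sum>j<N. scal A (g p (a k) (Y j)) (X j)) (w k))"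
    using X w by (intro sum.cong refl cl_lincomb_left[symmetric]) auto
  also have "\<dots> = x"
    unfolding x using dual[symmetric] a by (intro sum.cong refl) simp
  finally show "x = (\<Sum>j<N. cl p (X j) (D \<phi> p (Y j)))" ..
qed

section \<open>The Dirac operator as a matrix of operators in \<open>Diff M V\<close>\<close>

lemma Diff_sum:
  fixes P :: "nat \<Rightarrow> ('a \<Rightarrow> complex) \<Rightarrow> 'a \<Rightarrow> complex"
  assumes "\<And>j. j < N \<Longrightarrow> P j \<in> Diff M V"
  shows "(\<lambda>u p. \<Sum>j<N. P j u p) \<in> Diff M V"
  using assms
proof (induction N)
  case 0
  have "(\<lambda>p. 0) \<in> Cinf M UNIV" by (simp add: Cinf_def A.smooth_fun_const)
  from Diff.multiplication[OF this] show ?case by simp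
next
  case (Suc N)
  then show ?case by (simp add: Diff.sum)
qed

text \<open>In terms of the generators \<open>Z\<close>, \<open>T\<close> of \<open>W\<close>,
  differentiating \<open>\<xi>\<close> means differentiating its coordinate functions, up to
  zero-order terms from the derivatives of the \<open>Z l\<close>. The assumption on the anchor
  places the derivations along sections in \<open>Diff M V\<close>.\<close>

lemma Dirac_operator_in_Diff_bundle:
  assumes anchor: "\<And>X. X \<in> sections M A \<Longrightarrow> anchor_field M \<rho> X \<in> V"
  shows "Dirac_operator A g W D cl \<in> Diff_bundle M V W W"
proof -
  let ?P = "Dirac_operator A g W D cl"
  obtain N :: nat and X Y where A_gen: "\<forall>j<N. X j \<in> sections M A \<and> Y j \<in> sections M A"
    "\<forall>p. \<forall>a\<in>fibre A p. a = (\<Sum>j<N. scal A (g p a (Y j p)) (X j p))"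
    by (rule A.dual_generators[OF compact])
  have X: "X j \<in> sections M A" and Y: "Y j \<in> sections M A" if "j < N" for j
    using A_gen(1) that by auto
  have XY: "a = (\<Sum>j<N. scal A (g p a (Y j p)) (X j p))" if "a \<in> fibre A p" for p a
    using bspec[OF spec[OF A_gen(2)] that] .
  obtain K :: nat and Z T where W_gen: "\<forall>k<K. Z k \<in> sections M W \<and> T k \<in> sections M W"
    "\<forall>p. \<forall>w\<in>fibre W p. w = (\<Sum>k<K. scal W (h p w (T k p)) (Z k p))"
    by (rule W.dual_generators[OF compact])
  have Z: "Z k \<in> sections M W" and T: "T k \<in> sections M W" if "k < K" for k
    using W_gen(1) that by auto
  have ZT: "w = (\<Sum>k<K. scal W (h p w (T k p)) (Z k p))" if "w \<in> fibre W p" for p w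
    using bspec[OF spec[OF W_gen(2)] that] .
  note fib = section_in_fibre
  have Dirac: "?P \<xi> p = (\<Sum>j<N. cl p (X j p) (D \<xi> p (Y j p)))" if "\<xi> \<in> sections M W" for \<xi> p
    unfolding Dirac_operator_def
    using that XY X Y fib(1) by (intro Clifford_contraction_sharp) auto
  have P_section: "?P \<xi> \<in> sections M W" if \<xi>: "\<xi> \<in> sections M W" for \<xi>
  proof -
    have "(\<lambda>p. \<Sum>j<N. cl p (X j p) (D \<xi> p (Y j p))) \<in> sections M W"
      by (intro sum_section cl_section D_section X Y \<xi>) auto
    then show ?thesis using Dirac[OF \<xi>] by presburger
  qed
  \<comment> \<open>Coordinates against the \<open>T k\<close>, padded by \<open>0\<close> from
    \<open>K\<close> on as the encoding of complex \<open>K\<close>-tuples requires.\<close>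
  define \<iota> where "\<iota> = (\<lambda>p v k. if k < K then h p v (T k p) else 0)"
  define e where "e = (\<lambda>k l p. h p (Z l p) (T k p))"
  \<comment> \<open>The matrix \<open>e\<close> fixes the coordinates of every fibre vector. This
    identity yields idempotence, half of the range condition, and later the removal of both
    projections from the formula for the operator.\<close>
  have e_\<iota>: "(\<Sum>m<K. e k m p * h p v (T m p)) = h p v (T k p)" if "k < K" "v \<in> fibre W p" for k p v
  proof -
    have "h p v (T k p) = h p (\<Sum>m<K. scal W (h p v (T m p)) (Z m p)) (T k p)"
      using ZT[OF that(2)] by simp
    also have "\<dots> = (\<Sum>m<K. h p v (T m p) * h p (Z m p) (T k p))"
      using that(1) Z T fib(2) by (intro W.lincomb_left) auto
    finally show ?thesis by (simp add: e_def mult.commute)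
  qed
  have embedding: "bundle_embedding M W K \<iota> e"
    unfolding bundle_embedding_def
  proof (intro conjI allI impI ballI)
    fix p
    show "inj_on (\<iota> p) (fibre W p)"
    proof (rule inj_onI)
      fix v w assume v: "v \<in> fibre W p" and w: "w \<in> fibre W p" and eq: "\<iota> p v = \<iota> p w"
      have "h p v (T k p) = h p w (T k p)" if "k < K" for k
        using fun_cong[OF eq, of k] that by (simp add: \<iota>_def)
      then have "(\<Sum>k<K. scal W (h p v (T k p)) (Z k p)) = (\<Sum>k<K. scal W (h p w (T k p)) (Z k p))"
        by (intro sum.cong) auto
      then show "v = w" using ZT[OF v] ZT[OF w] by simp
    qed
    show "range (\<lambda>z k. if k < K then \<Sum>l<K. e k l p * z l else 0) = \<iota> p ` fibre W p"
    proof (intro equalityI subsetI)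
      fix x assume "x \<in> range (\<lambda>z k. if k < K then \<Sum>l<K. e k l p * z l else 0)"
      then obtain z where x: "x = (\<lambda>k. if k < K then \<Sum>l<K. e k l p * z l else 0)" by auto
      \<comment> \<open>Applying \<open>e\<close> to \<open>z\<close> gives the coordinates of the
        combination of the \<open>Z l\<close> with coefficients \<open>z\<close>.\<close>
      have "x = \<iota> p (\<Sum>l<K. scal W (z l) (Z l p))"
      proof
        fix k
        show "x k = \<iota> p (\<Sum>l<K. scal W (z l) (Z l p)) k"
          using W.lincomb_left[of "T k p" p "{..<K}" "\<lambda>l. Z l p" z] Z T fib(2)
          by (simp add: x \<iota>_def e_def mult.commute)
      qed
      moreover have "(\<Sum>l<K. scal W (z l) (Z l p)) \<in> fibre W p"
        using Z fib(2) by (intro W.fibre_sum W.fibre_scale) auto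
      ultimately show "x \<in> \<iota> p ` fibre W p" by blast
    next
      fix x assume "x \<in> \<iota> p ` fibre W p"
      then obtain v where v: "v \<in> fibre W p" "x = \<iota> p v" by auto
      have "x = (\<lambda>k. if k < K then \<Sum>l<K. e k l p * x l else 0)"
        using e_\<iota>[OF _ v(1)] by (auto simp: v(2) \<iota>_def)
      then show "x \<in> range (\<lambda>z k. if k < K then \<Sum>l<K. e k l p * z l else 0)" by blast
    qed
  next
    fix p v w assume "v \<in> fibre W p" "w \<in> fibre W p"
    then show "\<iota> p (v + w) = (\<lambda>k. \<iota> p v k + \<iota> p w k)"
      using T fib(2) by (auto simp: \<iota>_def W.add_left)
  next
    fix p v z assume "v \<in> fibre W p"
    then show "\<iota> p (scal W z v) = (\<lambda>k. z * \<iota> p v k)"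
      using T fib(2) by (auto simp: \<iota>_def W.scale_left)
  next
    have "smooth_fun M U (\<lambda>p. \<iota> p (s i p) k)"
      if f: "(U, r, s) \<in> frames W" and "i < r" "k < K" for U r s i k
    proof -
      have "W.smooth_section U (T k)"
        using T[OF \<open>k < K\<close>] W.smooth_section_subset[of UNIV] by (simp add: sections_def)
      then show ?thesis
        using W.smooth_metric[OF W.frame(2)[OF f \<open>i < r\<close>]] \<open>k < K\<close> by (simp add: \<iota>_def)
    qed
    then show "case x of (U, r, s) \<Rightarrow> \<forall>i<r. \<forall>k<K. smooth_fun M U (\<lambda>p. \<iota> p (s i p) k)"
      if "x \<in> frames W" for x
      using that by auto
  next
    fix k l assume "k < K" "l < K"
    then show "e k l \<in> Cinf M UNIV"
      unfolding e_def Cinf_def using metric_smooth Z T by auto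
  next
    fix p k l assume "k < K" "l < K"
    \<comment> \<open>Column \<open>l\<close> of \<open>e\<close> is the coordinate vector of
      \<open>Z l p\<close>, and such vectors are fixed by \<open>e\<close>.\<close>
    then show "(\<Sum>m<K. e k m p * e m l p) = e k l p"
      using e_\<iota>[of k "Z l p" p] Z fib(2) by (simp add: e_def)
  qed (simp_all add: \<iota>_def)
  \<comment> \<open>The Leibniz rule for \<open>u l\<close> times \<open>Z l\<close> gives a
    zero-order term, where \<open>Z l\<close> is differentiated, and a first-order term, where
    \<open>u l\<close> is; each is Clifford multiplied by \<open>X j\<close> and paired with
    \<open>T k\<close>.\<close>
  define Q where "Q = (\<lambda>k l u p.
    (\<Sum>j<N. h p (cl p (X j p) (D (Z l) p (Y j p))) (T k p)) * u p +
    (\<Sum>j<N. h p (cl p (X j p) (Z l p)) (T k p) * complex_action (anchor_field M \<rho> (Y j)) u p))"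
  have Q_Diff: "Q k l \<in> Diff M V" if kl: "k < K" "l < K" for k l
    unfolding Q_def
  proof (intro Diff.sum Diff_sum)
    show "(\<lambda>u p. (\<Sum>j<N. h p (cl p (X j p) (D (Z l) p (Y j p))) (T k p)) * u p) \<in> Diff M V"
      by (rule Diff.multiplication, unfold Cinf_def)
        (use kl in \<open>auto intro!: A.smooth_fun_sum metric_smooth cl_section D_section X Y Z T\<close>)
  next
    fix j assume j: "j < N"
    have "(\<lambda>p. h p (cl p (X j p) (Z l p)) (T k p)) \<in> Cinf M UNIV"
      unfolding Cinf_def using kl j by (auto intro!: metric_smooth cl_section X Z T)
    from Diff.composition[OF Diff.multiplication[OF this] Diff.derivation[OF anchor[OF Y[OF j]]]]
    show "(\<lambda>u p. h p (cl p (X j p) (Z l p)) (T k p) * complex_action (anchor_field M \<rho> (Y j)) u p) \<in> Diff M V" .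
  qed
  have Q: "h p (?P \<xi> p) (T k p) = (\<Sum>l<K. Q k l (\<lambda>q. h q (\<xi> q) (T l q)) p)"
    if \<xi>: "\<xi> \<in> sections M W" and k: "k < K" for \<xi> k p
  proof -
    define u where "u = (\<lambda>l q. h q (\<xi> q) (T l q))"
    have u: "smooth_fun M UNIV (u l)" if "l < K" for l
      unfolding u_def by (intro metric_smooth \<xi> T that)
    \<comment> \<open>Because the generators are global, this is an identity of sections on the
      whole manifold, to which \<open>D\<close> may be applied.\<close>
    have \<xi>_eq: "\<xi> = (\<lambda>q. \<Sum>l<K. scal W (u l q) (Z l q))"
      unfolding u_def using ZT fib(2)[OF \<xi>] by blast
    let ?C = "\<lambda>j l. complex_action (anchor_field M \<rho> (Y j)) (u l) p"
    have F: "cl p (X j p) (D (Z l) p (Y j p)) \<in> fibre W p" "cl p (X j p) (Z l p) \<in> fibre W p"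
      "D (Z l) p (Y j p) \<in> fibre W p" "Z l p \<in> fibre W p" "X j p \<in> fibre A p" if "j < N" "l < K" for j l
      using that X Y Z fib by (auto intro!: cl_fibre D_fibre)
    have D: "D \<xi> p (Y j p) = (\<Sum>l<K. scal W (u l p) (D (Z l) p (Y j p)) + scal W (?C j l) (Z l p))"
      if j: "j < N" for j
    proof -
      have "D \<xi> p (Y j p) = (\<Sum>l<K. D (\<lambda>q. scal W (u l q) (Z l q)) p (Y j p))"
        by (subst \<xi>_eq, rule D_sum) (use u Z in \<open>auto intro: scale_section\<close>)
      also have "\<dots> = (\<Sum>l<K. scal W (u l p) (D (Z l) p (Y j p)) + scal W (?C j l) (Z l p))"
        using u Z Y[OF j] by (intro sum.cong refl D_Leibniz) auto
      finally show ?thesis .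
    qed
    have h_term: "h p (cl p (X j p) (D \<xi> p (Y j p))) (T k p) =
        (\<Sum>l<K. u l p * h p (cl p (X j p) (D (Z l) p (Y j p))) (T k p) + ?C j l * h p (cl p (X j p) (Z l p)) (T k p))"
      if j: "j < N" for j
    proof -
      have "D \<xi> p (Y j p) = (\<Sum>l<K. scal W (u l p) (D (Z l) p (Y j p))) + (\<Sum>l<K. scal W (?C j l) (Z l p))"
        unfolding D[OF j] by (rule sum.distrib)
      moreover have "(\<Sum>l<K. scal W (u l p) (D (Z l) p (Y j p))) \<in> fibre W p" "(\<Sum>l<K. scal W (?C j l) (Z l p)) \<in> fibre W p"
        using F[OF j] by (auto intro!: W.fibre_sum W.fibre_scale)
      ultimately have "cl p (X j p) (D \<xi> p (Y j p)) =
          cl p (X j p) (\<Sum>l<K. scal W (u l p) (D (Z l) p (Y j p))) + cl p (X j p) (\<Sum>l<K. scal W (?C j l) (Z l p))"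
        using fib(1)[OF X[OF j]] by (simp only: cl_add_right)
      also have "cl p (X j p) (\<Sum>l<K. scal W (u l p) (D (Z l) p (Y j p))) =
          (\<Sum>l<K. scal W (u l p) (cl p (X j p) (D (Z l) p (Y j p))))"
        using F[OF j] fib(1)[OF X[OF j]] by (intro cl_lincomb_right) auto
      also have "cl p (X j p) (\<Sum>l<K. scal W (?C j l) (Z l p)) = (\<Sum>l<K. scal W (?C j l) (cl p (X j p) (Z l p)))"
        using F[OF j] fib(1)[OF X[OF j]] by (intro cl_lincomb_right) auto
      finally have "h p (cl p (X j p) (D \<xi> p (Y j p))) (T k p) =
          h p (\<Sum>l<K. scal W (u l p) (cl p (X j p) (D (Z l) p (Y j p)))) (T k p) +
          h p (\<Sum>l<K. scal W (?C j l) (cl p (X j p) (Z l p))) (T k p)"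
        using F[OF j] fib(2)[OF T[OF k]] by (simp only:) (intro W.add_left W.fibre_sum W.fibre_scale; auto)
      also have "h p (\<Sum>l<K. scal W (u l p) (cl p (X j p) (D (Z l) p (Y j p)))) (T k p) =
          (\<Sum>l<K. u l p * h p (cl p (X j p) (D (Z l) p (Y j p))) (T k p))"
        using F[OF j] fib(2)[OF T[OF k]] by (intro W.lincomb_left) auto
      also have "h p (\<Sum>l<K. scal W (?C j l) (cl p (X j p) (Z l p))) (T k p) =
          (\<Sum>l<K. ?C j l * h p (cl p (X j p) (Z l p)) (T k p))"
        using F[OF j] fib(2)[OF T[OF k]] by (intro W.lincomb_left) auto
      finally show ?thesis by (simp only: sum.distrib)
    qed
    have "h p (?P \<xi> p) (T k p) = (\<Sum>j<N. h p (cl p (X j p) (D \<xi> p (Y j p))) (T k p))"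
      unfolding Dirac[OF \<xi>] using fib(2)[OF T[OF k]] fib(1)[OF X] fib(1)[OF Y]
      by (intro W.sum_left cl_fibre D_fibre[OF \<xi>]) auto
    also have "\<dots> = (\<Sum>j<N. \<Sum>l<K. u l p * h p (cl p (X j p) (D (Z l) p (Y j p))) (T k p)
        + ?C j l * h p (cl p (X j p) (Z l p)) (T k p))"
      by (intro sum.cong refl h_term) simp
    also have "\<dots> = (\<Sum>l<K. \<Sum>j<N. u l p * h p (cl p (X j p) (D (Z l) p (Y j p))) (T k p)
        + ?C j l * h p (cl p (X j p) (Z l p)) (T k p))"
      by (rule sum.swap)
    also have "\<dots> = (\<Sum>l<K. Q k l (u l) p)"
      by (simp add: Q_def sum.distrib sum_distrib_left mult.commute)
    finally show ?thesis by (simp only: u_def)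
  qed
  show ?thesis
    unfolding Diff_bundle_def
  proof (intro CollectI conjI ballI)
    show "\<exists>N\<^sub>1 \<iota>\<^sub>1 e\<^sub>1 N\<^sub>2 \<iota>\<^sub>2 e\<^sub>2 Q. bundle_embedding M W N\<^sub>1 \<iota>\<^sub>1 e\<^sub>1 \<and> bundle_embedding M W N\<^sub>2 \<iota>\<^sub>2 e\<^sub>2 \<and>
        (\<forall>k<N\<^sub>2. \<forall>l<N\<^sub>1. Q k l \<in> Diff M V) \<and>
        (\<forall>\<xi>\<in>sections M W. \<forall>p. \<forall>k<N\<^sub>2. \<iota>\<^sub>2 p (?P \<xi> p) k =
           (\<Sum>m<N\<^sub>2. e\<^sub>2 k m p * (\<Sum>l<N\<^sub>1. Q m l (\<lambda>q. \<Sum>j<N\<^sub>1. e\<^sub>1 l j q * \<iota>\<^sub>1 q (\<xi> q) j) p)))"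
    \<comment> \<open>The same embedding serves for source and target. The inner projection fixes
      the coordinates of \<open>\<xi>\<close> and the outer one those of \<open>?P \<xi>\<close>, so
      only \<open>Q\<close> remains.\<close>
    proof (rule exI[of _ K], rule exI[of _ \<iota>], rule exI[of _ e], rule exI[of _ K], rule exI[of _ \<iota>],
        rule exI[of _ e], rule exI[of _ Q], intro conjI ballI allI impI embedding Q_Diff)
      fix \<xi> p k assume \<xi>: "\<xi> \<in> sections M W" and k: "k < K"
      have "(\<Sum>m<K. e k m p * (\<Sum>l<K. Q m l (\<lambda>q. \<Sum>j<K. e l j q * \<iota> q (\<xi> q) j) p)) =
          (\<Sum>m<K. e k m p * (\<Sum>l<K. Q m l (\<lambda>q. h q (\<xi> q) (T l q)) p))"
        using e_\<iota> fib(2)[OF \<xi>] by (simp add: \<iota>_def)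
      also have "\<dots> = (\<Sum>m<K. e k m p * h p (?P \<xi> p) (T m p))"
        using Q[OF \<xi>] by simp
      also have "\<dots> = \<iota> p (?P \<xi> p) k"
        using e_\<iota>[OF k fib(2)[OF P_section[OF \<xi>]]] k by (simp add: \<iota>_def)
      finally show "\<iota> p (?P \<xi> p) k =
          (\<Sum>m<K. e k m p * (\<Sum>l<K. Q m l (\<lambda>q. \<Sum>j<K. e l j q * \<iota> q (\<xi> q) j) p))" ..
    qed
  qed (rule P_section)
qed

end

section \<open>Application to a Clifford module over a Lie structure at infinity\<close>

theorem theorem4p13:
  fixes M :: "('a::{t2_space,second_countable_topology}, 'n::finite) manifold"
    and V :: "(('a \<Rightarrow> real) \<Rightarrow> 'a \<Rightarrow> real) set"
    and A :: "('a, real, 'e::ab_group_add) vbundle"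
    and \<rho> :: "'a \<Rightarrow> 'e \<Rightarrow> ('a \<Rightarrow> real) \<Rightarrow> real"
    and g :: "'a \<Rightarrow> 'e \<Rightarrow> 'e \<Rightarrow> real"
    and nabla :: "('a \<Rightarrow> 'e) \<Rightarrow> 'a \<Rightarrow> 'e \<Rightarrow> 'e"
    and W :: "('a, complex, 'w::ab_group_add) vbundle"
    and h :: "'a \<Rightarrow> 'w \<Rightarrow> 'w \<Rightarrow> complex"
    and nablaW :: "('a \<Rightarrow> 'w) \<Rightarrow> 'a \<Rightarrow> 'e \<Rightarrow> 'w"
    and cl :: "'a \<Rightarrow> 'e \<Rightarrow> 'w \<Rightarrow> 'w"
  assumes "Riemannian_Lie_structure M V A \<rho> g"
    and "orientable M A"
    and "extends_Levi_Civita M A \<rho> g nabla"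
    and "Clifford_module M A \<rho> g nabla W h nablaW cl"
  shows "Dirac_operator A g W nablaW cl \<in> Diff_bundle M V W W"
proof -
  have M: "corner_atlas M" "compact (UNIV :: 'a set)" and g: "bundle_metric M A g"
    and A: "vector_bundle M A" "bij_betw (anchor_field M \<rho>) (sections M A) V"
    using assms(1) unfolding Riemannian_Lie_structure_def Lie_structure_at_infinity_def
      manifold_with_corners_def structural_bundle_def by auto
  have W: "vector_bundle M W" "Hermitian_metric M W h" "A_connection M A \<rho> W nablaW" "Clifford_map M A W cl"
    using assms(4) unfolding Clifford_module_def by auto
  interpret corner_manifold M by unfold_locales (rule M(1))
  interpret A: metric_bundle M A "\<lambda>x. x" g
    by (rule metric_bundle_real[OF A(1) g])
  interpret W: metric_bundle M W cnj h
    by (rule metric_bundle_complex[OF W(1,2)])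
  interpret Clifford_bundle M A g W h \<rho> nablaW cl
    using M(2) g W(3,4) unfolding bundle_metric_def by unfold_locales auto
  show ?thesis
    \<comment> \<open>The anchor identifies sections of \<open>A\<close> with elements of
      \<open>V\<close>, so derivations along sections are among the generators of
      \<open>Diff M V\<close>.\<close>
    using bij_betwE[OF A(2)] by (intro Dirac_operator_in_Diff_bundle) auto
qed

end
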